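(* Let $\rho,\sigma$ be $d\times d$ density matrices. Then the set $\{F(\rho,U\sigma U^\dagger): U\in\mathcal{U}(d)\}$ equals the closed interval \[ \Big[\sum_{j=1}^d\sqrt{\lambda^\downarrow_j(\rho)\lambda^\uparrow_j(\sigma)},\ \sum_{j=1}^d\sqrt{\lambda^\downarrow_j(\rho)\lambda^\downarrow_j(\sigma)}\Big]. \]
   Context: A density matrix is a positive semidefinite complex matrix of trace one. $\mathcal{U}(d)$ denotes the group of $d\times d$ unitary matrices. The fidelity of density matrices is $F(\rho,\sigma)=\operatorname{Tr}\sqrt{\sqrt{\rho}\,\sigma\sqrt{\rho}}$. For a Hermitian matrix $A$, $\lambda^\downarrow(A)$ is the vector of its eigenvalues (with multiplicity) in decreasing order and $\lambda^\uparrow(A)$ the same in increasing order. *)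

theory Defs
  imports "Jordan_Normal_Form.Schur_Decomposition"
begin

definition mtrace :: "complex mat \<Rightarrow> complex" where
  "mtrace A = (\<Sum>i<dim_row A. A $$ (i,i))"

definition hermitian_mat :: "nat \<Rightarrow> complex mat \<Rightarrow> bool" where
  "hermitian_mat d A \<longleftrightarrow> A \<in> carrier_mat d d \<and> mat_adjoint A = A"

definition psd_mat :: "nat \<Rightarrow> complex mat \<Rightarrow> bool" where
  "psd_mat d A \<longleftrightarrow> hermitian_mat d A \<and>
     (\<forall>v \<in> carrier_vec d. 0 \<le> Re (conjugate v \<bullet> (A *\<^sub>v v)))"

definition density_mat :: "nat \<Rightarrow> complex mat \<Rightarrow> bool" where
  "density_mat d A \<longleftrightarrow> psd_mat d A \<and> mtrace A = 1"

definition unitary_mat :: "nat \<Rightarrow> complex mat \<Rightarrow> bool" where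
  "unitary_mat d U \<longleftrightarrow> U \<in> carrier_mat d d \<and> U * mat_adjoint U = 1\<^sub>m d"

definition psd_sqrt :: "complex mat \<Rightarrow> complex mat" where
  "psd_sqrt A = (THE B. psd_mat (dim_row A) B \<and> B * B = A)"

(* fidelity F(rho,sigma) = Tr sqrt(sqrt rho sigma sqrt rho); real-valued (trace of a PSD matrix) *)
definition fidelity :: "complex mat \<Rightarrow> complex mat \<Rightarrow> real" where
  "fidelity \<rho> \<sigma> = Re (mtrace (psd_sqrt (psd_sqrt \<rho> * \<sigma> * psd_sqrt \<rho>)))"

(* eigenvalues with multiplicity (roots of the characteristic polynomial), of a Hermitian
   matrix, hence real; listed in increasing / decreasing order *)
definition eig_up :: "complex mat \<Rightarrow> real list" where
  "eig_up A = sorted_list_of_multiset (image_mset Re (proots (char_poly A)))"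

definition eig_down :: "complex mat \<Rightarrow> real list" where
  "eig_down A = rev (eig_up A)"

end

theory Submission
  imports Defs "HOL-Computational_Algebra.Fundamental_Theorem_Algebra"
begin

text \<open>Diagonalise \<open>\<rho> = V diag(a\<^sup>2) V\<^sup>*\<close> and \<open>\<sigma> = W diag(b\<^sup>2) W\<^sup>*\<close> with \<open>a\<close>, \<open>b\<close>
  decreasing. The fidelity of \<open>\<rho>\<close> and \<open>U \<sigma> U\<^sup>*\<close> is the trace norm of \<open>M = diag(a) X diag(b)\<close>,
  where \<open>X = V\<^sup>* U W\<close> runs through all unitary matrices. The trace norm of \<open>M\<close> is the maximum of
  \<open>Re Tr (Y M)\<close> over partial isometries \<open>Y\<close>. For a maximising \<open>Y\<close>, the inequality
  \<open>\<bar>y x\<bar> \<le> (\<bar>y\<bar>\<^sup>2 + \<bar>x\<bar>\<^sup>2) / 2\<close> turns the trace into a bilinear form in \<open>a\<close> and \<open>b\<close> with a doubly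
  substochastic matrix, bounded by rearrangement; the choice \<open>Y = X\<^sup>*\<close> gives
  the lower bound in the same way. The variational formula also makes the trace norm Lipschitz in the
  entries of \<open>M\<close>, so the intermediate value theorem along a path of unitaries from the identity to
  the reversal permutation yields every value in between.\<close>

section \<open>Adjoints and unitary matrices\<close>

lemma mat_adjoint_eq: "mat_adjoint A = map_mat cnj (transpose_mat A)"
  by (rule eq_matI) (auto simp: mat_adjoint_def mat_of_rows_def)

lemma mat_adjoint_dim [simp]:
  "dim_row (mat_adjoint A) = dim_col A" "dim_col (mat_adjoint A) = dim_row A"
  by (auto simp: mat_adjoint_def)

lemma mat_adjoint_carrier [simp]:
  "mat_adjoint A \<in> carrier_mat m n \<longleftrightarrow> A \<in> carrier_mat n m"
  unfolding carrier_mat_def by simp blast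

lemma mat_adjoint_index [simp]:
  "i < dim_col A \<Longrightarrow> j < dim_row A \<Longrightarrow> mat_adjoint A $$ (i,j) = cnj (A $$ (j,i))"
  by (simp add: mat_adjoint_eq)

lemma mat_adjoint_adjoint [simp]: "mat_adjoint (mat_adjoint A) = (A :: complex mat)"
  by (rule eq_matI) auto

lemma mat_adjoint_mult:
  fixes A B :: "complex mat"
  assumes "A \<in> carrier_mat n m" "B \<in> carrier_mat m k"
  shows "mat_adjoint (A * B) = mat_adjoint B * mat_adjoint A"
  using assms by (intro eq_matI) (auto simp: scalar_prod_def intro!: sum.cong)

lemma mat_adjoint_one [simp]: "mat_adjoint (1\<^sub>m n) = (1\<^sub>m n :: complex mat)"
  by (rule eq_matI) auto

lemma mat_diag_carrier_iff [simp]: "mat_diag n f \<in> carrier_mat r c \<longleftrightarrow> r = n \<and> c = n"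
  by (auto simp: mat_diag_def)

lemma mat_diag_index [simp]:
  "i < n \<Longrightarrow> j < n \<Longrightarrow> mat_diag n f $$ (i,j) = (if i = j then f j else 0)"
  by (simp add: mat_diag_def)

lemma mat_diag_dims [simp]: "dim_row (mat_diag n f) = n" "dim_col (mat_diag n f) = n"
  by (auto simp: mat_diag_def)

lemma mat_adjoint_diag [simp]: "mat_adjoint (mat_diag n f) = mat_diag n (\<lambda>i. cnj (f i))"
  by (rule eq_matI) auto

lemma mat_diag_cong: "(\<And>i. i < n \<Longrightarrow> f i = g i) \<Longrightarrow> mat_diag n f = mat_diag n g"
  by (rule eq_matI) auto

lemma index_mult_mat_sum:
  "A \<in> carrier_mat n m \<Longrightarrow> B \<in> carrier_mat m k \<Longrightarrow> i < n \<Longrightarrow> j < k \<Longrightarrow>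
    (A * B) $$ (i,j) = (\<Sum>l<m. A $$ (i,l) * B $$ (l,j))"
  by (auto simp: scalar_prod_def atLeast0LessThan)

lemma mtrace_mult_comm:
  assumes "A \<in> carrier_mat n m" "B \<in> carrier_mat m n"
  shows "mtrace (A * B) = mtrace (B * A)"
proof -
  have "mtrace (A * B) = (\<Sum>i<n. \<Sum>j<m. A $$ (i,j) * B $$ (j,i))"
    using assms by (auto simp: mtrace_def index_mult_mat_sum simp del: index_mult_mat(1) intro!: sum.cong)
  also have "\<dots> = (\<Sum>j<m. \<Sum>i<n. B $$ (j,i) * A $$ (i,j))"
    by (subst sum.swap) (simp add: mult.commute)
  also have "\<dots> = mtrace (B * A)"
    using assms by (auto simp: mtrace_def index_mult_mat_sum simp del: index_mult_mat(1) intro!: sum.cong)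
  finally show ?thesis .
qed

lemma mtrace_diag [simp]: "mtrace (mat_diag n f) = (\<Sum>i<n. f i)"
  by (simp add: mtrace_def)

text \<open>A one-sided inverse of a square matrix is two-sided, so the defining equation also
  yields the third fact.\<close>

lemma unitary_matD:
  assumes "unitary_mat d U"
  shows "U \<in> carrier_mat d d" "U * mat_adjoint U = 1\<^sub>m d" "mat_adjoint U * U = 1\<^sub>m d"
  using assms mat_mult_left_right_inverse[of U d "mat_adjoint U"]
  by (auto simp: unitary_mat_def)

lemma unitary_mat_adjoint: "unitary_mat d U \<Longrightarrow> unitary_mat d (mat_adjoint U)"
  by (simp add: unitary_mat_def[of d "mat_adjoint U"] unitary_matD)

lemma unitary_mat_one: "unitary_mat d (1\<^sub>m d)"
  by (simp add: unitary_mat_def)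

lemma unitary_mat_mult:
  assumes U: "unitary_mat d U" and V: "unitary_mat d V"
  shows "unitary_mat d (U * V)"
proof -
  note u = unitary_matD[OF U] and v = unitary_matD[OF V]
  have "U * V * mat_adjoint (U * V) = U * (V * mat_adjoint V) * mat_adjoint U"
    using u(1) v(1) by (simp add: mat_adjoint_mult[of _ d d _ d] assoc_mult_mat[of _ d d _ d _ d])
  then show ?thesis
    using u v by (simp add: unitary_mat_def)
qed

text \<open>\<open>v\<close> is completed to a basis and orthogonalised by Gram-Schmidt, which keeps
  \<open>v\<close> in front; dividing each column by its norm makes the columns orthonormal. The
  factor \<open>c\<close> absorbs this scaling.\<close>

lemma unitary_with_first_column:
  fixes v :: "complex vec"
  assumes v: "v \<in> carrier_vec n" and v0: "v \<noteq> 0\<^sub>v n"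
  obtains W c where "unitary_mat n W" "col W 0 = c \<cdot>\<^sub>v v"
proof -
  interpret cof_vec_space n "TYPE(complex)" .
  define b where "b = basis_completion v"
  define ws where "ws = gram_schmidt n b"
  define W where "W = mat_of_cols n ws"
  note bc = basis_completion[OF v v0, folded b_def]
  have n: "n > 0" using v v0 by (cases n) auto
  obtain vs where bv: "b = v # vs" using bc(6,7) n by (cases b) auto
  have ws: "set ws \<subseteq> carrier_vec n" "corthogonal ws" "length ws = n"
    using gram_schmidt_result[OF bc(2,4,5) refl, folded ws_def] bc(6) by auto
  have hd: "hd ws = v" using gram_schmidt_hd[OF v, of vs, folded bv] by (simp add: ws_def)
  have W: "W \<in> carrier_mat n n" using ws by (auto simp: W_def)
  have col: "col W i = ws ! i" if "i < n" for i
    using that ws by (auto simp: W_def intro!: col_mat_of_cols)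
  have col0: "col W 0 = v" using col[of 0] n hd ws by (cases ws) auto
  define g where "g i = ws ! i \<bullet>c ws ! i" for i
  define D where "D = mat_diag n (\<lambda>i. 1 / csqrt (g i))"
  define V where "V = W * D"
  have D: "D \<in> carrier_mat n n" by (simp add: D_def)
  have V: "V \<in> carrier_mat n n" using W D by (simp add: V_def)
  have orth: "mat_adjoint W * W = mat_diag n g"
  proof (rule eq_matI)
    fix i j assume "i < dim_row (mat_diag n g)" "j < dim_col (mat_diag n g)"
    then have ij: "i < n" "j < n" by auto
    have "ws ! i \<in> carrier_vec n" "ws ! j \<in> carrier_vec n" using ws ij by auto
    have "(mat_adjoint W * W) $$ (i,j) = (\<Sum>k<n. cnj (W $$ (k,i)) * W $$ (k,j))"
      using W ij by (simp add: index_mult_mat_sum[of _ n n _ n] del: index_mult_mat(1))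
    also have "\<dots> = ws ! j \<bullet>c ws ! i"
      using W ij ws by (simp add: col[symmetric] scalar_prod_def atLeast0LessThan mult.commute)
    finally show "(mat_adjoint W * W) $$ (i,j) = mat_diag n g $$ (i,j)"
      using ij corthogonalD[OF ws(2), of j i] ws by (auto simp: g_def)
  qed (use W in auto)
  \<comment> \<open>\<open>g i\<close> is the squared norm of column \<open>i\<close>, here a
    complex number. Being real and positive makes \<open>csqrt (g i)\<close> real, so the
    conjugation in the computation below does not change it.\<close>
  have g: "g i \<in> \<real>" "Re (g i) > 0" if "i < n" for i
  proof -
    have wi: "ws ! i \<in> carrier_vec n" using ws that by auto
    have "g i \<noteq> 0" using corthogonalD[OF ws(2), of i i] that ws by (auto simp: g_def)
    moreover have "g i \<ge> 0" unfolding g_def by (rule conjugate_square_ge_0_vec)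
    ultimately show "g i \<in> \<real>" "Re (g i) > 0"
      using complex_eqI[of "g i" 0] by (force simp: less_eq_complex_def complex_is_Real_iff)+
  qed
  have "mat_adjoint V * V = mat_adjoint D * (mat_adjoint W * W) * D"
    using W D by (simp add: V_def mat_adjoint_mult[of _ n n _ n] assoc_mult_mat[of _ n n _ n _ n])
  also have "\<dots> = mat_diag n (\<lambda>i. cnj (1 / csqrt (g i)) * g i * (1 / csqrt (g i)))"
    by (simp only: orth D_def mat_adjoint_diag mat_diag_diag)
  also have "\<dots> = mat_diag n (\<lambda>i. 1)"
  proof (rule mat_diag_cong)
    fix i assume "i < n"
    from g[OF this] obtain r where r: "g i = of_real r" "r > 0"
      by (auto elim!: Reals_cases)
    have "csqrt (g i) = of_real (sqrt r)" using r by (simp add: csqrt_of_real_nonneg)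
    moreover have "complex_of_real (sqrt r) * of_real (sqrt r) = of_real r"
      using r by (simp flip: of_real_mult)
    ultimately show "cnj (1 / csqrt (g i)) * g i * (1 / csqrt (g i)) = 1"
      using r by simp
  qed
  finally have "mat_adjoint V * V = 1\<^sub>m n" by simp
  then have "unitary_mat n V"
    using V mat_mult_left_right_inverse[of "mat_adjoint V" n V] by (simp add: unitary_mat_def)
  moreover have "col V 0 = (1 / csqrt (g 0)) \<cdot>\<^sub>v v"
    unfolding V_def D_def mat_diag_mult_right[OF W] col0[symmetric]
    using W n by (intro eq_vecI) auto
  ultimately show ?thesis by (rule that)
qed

section \<open>Spectral theorem for Hermitian matrices\<close>

lemma unitary_conj_cancel:
  assumes W: "unitary_mat n W" and A: "A \<in> carrier_mat n n"
  shows "W * (mat_adjoint W * A * W) * mat_adjoint W = A"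
proof -
  note w = unitary_matD[OF W]
  have "W * (mat_adjoint W * A * W) * mat_adjoint W = (W * mat_adjoint W) * A * (W * mat_adjoint W)"
    using w(1) A by (simp add: assoc_mult_mat[of _ n n _ n _ n])
  then show ?thesis using A by (simp add: w(2))
qed

lemma mat_adjoint_mult3:
  fixes A B C :: "complex mat"
  assumes "A \<in> carrier_mat n n" "B \<in> carrier_mat n n" "C \<in> carrier_mat n n"
  shows "mat_adjoint (A * B * C) = mat_adjoint C * mat_adjoint B * mat_adjoint A"
  using assms by (simp add: mat_adjoint_mult[of _ n n _ n] assoc_mult_mat[of _ n n _ n _ n])

lemma similar_mat_unitary_conj:
  assumes W: "unitary_mat n W" and A: "A \<in> carrier_mat n n"
  shows "similar_mat A (mat_adjoint W * A * W)"
  unfolding similar_mat_def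
  using unitary_matD[OF W] A unitary_conj_cancel[OF W A]
  by (intro exI[of _ W] exI[of _ "mat_adjoint W"] similar_mat_witI[of _ _ n]) simp_all

text \<open>Deflation along the list of roots: the head yields an eigenvector, a unitary with this
  direction as first column splits off a 1x1 block, and the remaining block is Hermitian with the
  tail as its roots. Taking the list as a parameter lets the caller choose the order of the
  eigenvalues on the diagonal.\<close>

lemma spectral_hermitian:
  assumes "hermitian_mat n A" and "char_poly A = (\<Prod>e\<leftarrow>es. [:-e, 1:])"
  shows "length es = n \<and> (\<exists>V. unitary_mat n V \<and> A = V * mat_diag n ((!) es) * mat_adjoint V)"
  using assms
proof (induction es arbitrary: n A)
  case Nil
  then have A: "A \<in> carrier_mat n n" by (simp add: hermitian_mat_def)
  have "n = 0" using degree_monic_char_poly[OF A] Nil by simp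
  then show ?case
    using A by (auto intro!: exI[of _ "1\<^sub>m 0"] eq_matI simp: unitary_mat_one)
next
  case (Cons e es)
  then have A: "A \<in> carrier_mat n n" and herm: "mat_adjoint A = A"
    by (auto simp: hermitian_mat_def)
  have "eigenvalue A e"
    using Cons.prems(2) by (simp add: eigenvalue_root_char_poly[OF A])
  then obtain v where v: "v \<in> carrier_vec n" "v \<noteq> 0\<^sub>v n" "A *\<^sub>v v = e \<cdot>\<^sub>v v"
    using A by (auto simp: eigenvalue_def eigenvector_def)
  then obtain m where n: "n = Suc m" by (cases n) auto
  obtain W c where W: "unitary_mat n W" and col: "col W 0 = c \<cdot>\<^sub>v v"
    using unitary_with_first_column[OF v(1,2)] .
  note w = unitary_matD[OF W]
  define B where "B = mat_adjoint W * A * W"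
  have B: "B \<in> carrier_mat n n" using w(1) A by (simp add: B_def)
  have hB: "mat_adjoint B = B"
    using w(1) A herm unfolding B_def
    by (subst mat_adjoint_mult3[of _ n]) (simp_all add: assoc_mult_mat[of _ n n _ n _ n])
  have BW: "B = mat_adjoint W * (A * W)"
    using w(1) A by (simp add: B_def assoc_mult_mat[of _ n n _ n _ n])
  have colAW: "col (A * W) 0 = e \<cdot>\<^sub>v col W 0"
  proof -
    have "col (A * W) 0 = A *\<^sub>v col W 0" using col_mult2[OF A w(1)] n by simp
    also have "\<dots> = c \<cdot>\<^sub>v (A *\<^sub>v v)"
      unfolding col by (rule mult_mat_vec[OF A v(1)])
    also have "\<dots> = e \<cdot>\<^sub>v col W 0"
      by (simp add: v(3) col smult_smult_assoc mult.commute)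
    finally show ?thesis .
  qed
  \<comment> \<open>Orthonormality of the columns of \<open>W\<close> turns column 0 of
    \<open>B\<close> into \<open>e\<close> times the first unit vector.\<close>
  have B0: "B $$ (i,0) = (if i = 0 then e else 0)" if "i < n" for i
  proof -
    have "B $$ (i,0) = row (mat_adjoint W) i \<bullet> (e \<cdot>\<^sub>v col W 0)"
      using w(1) A n that by (simp add: BW colAW)
    also have "\<dots> = e * (mat_adjoint W * W) $$ (i,0)"
      using w(1) n that by simp
    finally show ?thesis using that n by (simp add: w(3))
  qed
  \<comment> \<open>Hermitian symmetry carries the zeros of the first column over to the first
    row.\<close>
  have B0': "B $$ (0,i) = (if i = 0 then e else 0)" if "i < n" for i
  proof -
    have "B $$ (0,i) = cnj (B $$ (i,0))"
      using arg_cong[OF hB, of "\<lambda>M. M $$ (0,i)"] that n B by simp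
    then show ?thesis using B0[of i] B0[of 0] that n by auto
  qed
  define B3 where "B3 = mat m m (\<lambda>(i,j). B $$ (Suc i, Suc j))"
  have B3: "B3 \<in> carrier_mat m m" by (simp add: B3_def)
  define E where "E = mat 1 1 (\<lambda>_. e)"
  have E: "E \<in> carrier_mat 1 1" by (simp add: E_def)
  have Bblock: "B = four_block_mat E (0\<^sub>m 1 m) (0\<^sub>m m 1) B3"
  proof (rule eq_matI)
    fix i j
    assume "i < dim_row (four_block_mat E (0\<^sub>m 1 m) (0\<^sub>m m 1) B3)"
      "j < dim_col (four_block_mat E (0\<^sub>m 1 m) (0\<^sub>m m 1) B3)"
    then have ij: "i < n" "j < n" by (auto simp: n E_def B3_def)
    then show "B $$ (i,j) = four_block_mat E (0\<^sub>m 1 m) (0\<^sub>m m 1) B3 $$ (i,j)"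
      using B0[of i] B0'[of j] by (auto simp: n E_def B3_def)
  qed (use B n in \<open>auto simp: E_def B3_def\<close>)
  have hB3: "hermitian_mat m B3"
    unfolding hermitian_mat_def
  proof
    show "mat_adjoint B3 = B3"
    proof (rule eq_matI)
      fix i j assume "i < dim_row B3" "j < dim_col B3"
      then have ij: "i < m" "j < m" by (auto simp: B3_def)
      then show "mat_adjoint B3 $$ (i,j) = B3 $$ (i,j)"
        using arg_cong[OF hB, of "\<lambda>M. M $$ (Suc i, Suc j)"] B by (simp add: B3_def n)
    qed (auto simp: B3_def)
  qed (rule B3)
  have "char_poly A = char_poly B"
    unfolding B_def by (rule char_poly_similar[OF similar_mat_unitary_conj[OF W A]])
  also have "\<dots> = char_poly E * char_poly B3"
    unfolding Bblock by (rule char_poly_four_block_zeros_col[OF E _ B3]) simp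
  also have "char_poly E = [:-e, 1:]"
    by (simp add: E_def char_poly_defs det_def sign_def)
  \<comment> \<open>Cancelling the nonzero factor for \<open>e\<close> leaves exactly the tail
    \<open>es\<close>, in its given order.\<close>
  finally have "char_poly B3 = (\<Prod>e\<leftarrow>es. [:-e, 1:])"
    unfolding Cons.prems(2) by (simp del: mult_pCons_left)
  from Cons.IH[OF hB3 this] obtain V where len: "length es = m" and V: "unitary_mat m V"
    and B3V: "B3 = V * mat_diag m ((!) es) * mat_adjoint V" by auto
  note v' = unitary_matD[OF V]
  \<comment> \<open>The block sum of 1 and \<open>V\<close> diagonalises \<open>B\<close>, hence
    \<open>W * P\<close> diagonalises \<open>A\<close>.\<close>
  define P where "P = four_block_mat (1\<^sub>m 1) (0\<^sub>m 1 m) (0\<^sub>m m 1) V"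
  define D where "D = mat_diag n ((!) (e # es))"
  have P: "P \<in> carrier_mat n n" using four_block_carrier_mat[of "1\<^sub>m 1" 1 1 V m m] v'(1) by (simp add: P_def n)
  have Pa: "mat_adjoint P = four_block_mat (1\<^sub>m 1) (0\<^sub>m 1 m) (0\<^sub>m m 1) (mat_adjoint V)"
    using v'(1) by (intro eq_matI) (auto simp: P_def)
  have Dblock: "D = four_block_mat E (0\<^sub>m 1 m) (0\<^sub>m m 1) (mat_diag m ((!) es))"
    by (rule eq_matI) (auto simp: D_def E_def n nth_Cons')
  have "P * mat_adjoint P = 1\<^sub>m n"
    unfolding P_def Pa[unfolded P_def]
    using v' by (subst mult_four_block_mat[of _ 1 1 _ m _ m _ _ 1 _ m]) (auto simp: n)
  then have uP: "unitary_mat n P" using P by (simp add: unitary_mat_def)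
  have "P * D = four_block_mat E (0\<^sub>m 1 m) (0\<^sub>m m 1) (V * mat_diag m ((!) es))"
    unfolding P_def Dblock
    using v' E by (subst mult_four_block_mat[of _ 1 1 _ m _ m _ _ 1 _ m]) auto
  then have "P * D * mat_adjoint P = B"
    unfolding Pa Bblock B3V
    using v' E
    by (simp, subst mult_four_block_mat[of _ 1 1 _ m _ m _ _ 1 _ m]) auto
  then have "A = W * (P * D * mat_adjoint P) * mat_adjoint W"
    using unitary_conj_cancel[OF W A] by (simp add: B_def)
  also have "\<dots> = (W * P) * D * mat_adjoint (W * P)"
    using w(1) P by (simp add: D_def mat_adjoint_mult[of _ n n _ n] assoc_mult_mat[of _ n n _ n _ n])
  finally show ?case
    using unitary_mat_mult[OF W uP] len n unfolding D_def by auto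
qed

section \<open>Positive semidefinite matrices and square roots\<close>

text \<open>Turns quadratic forms into entries of matrix products, where associativity and the
  adjoint rules apply.\<close>

lemma quadratic_form_index:
  fixes A :: "complex mat"
  assumes "A \<in> carrier_mat n n" "X \<in> carrier_mat n k" "i < k"
  shows "conjugate (col X i) \<bullet> (A *\<^sub>v col X i) = (mat_adjoint X * (A * X)) $$ (i,i)"
  using assms by (auto simp: scalar_prod_def intro!: sum.cong)

text \<open>The quadratic form of \<open>M * mat_adjoint M\<close> at \<open>v\<close> is the
  squared norm of \<open>mat_adjoint M\<close> applied to \<open>v\<close>.\<close>

lemma psd_mat_mult_adjoint:
  assumes M: "M \<in> carrier_mat n n"
  shows "psd_mat n (M * mat_adjoint M)"
  unfolding psd_mat_def hermitian_mat_def
proof (intro conjI ballI)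
  show "M * mat_adjoint M \<in> carrier_mat n n" using M by simp
  show "mat_adjoint (M * mat_adjoint M) = M * mat_adjoint M"
    using M by (simp add: mat_adjoint_mult[of _ n n _ n])
  fix v :: "complex vec" assume v: "v \<in> carrier_vec n"
  \<comment> \<open>The vector becomes a one-column matrix so that the whole computation takes place
    among matrices.\<close>
  define X where "X = mat_of_cols n [v]"
  have X: "X \<in> carrier_mat n 1" and vX: "v = col X 0"
    using v by (auto simp: X_def col_mat_of_cols)
  define Y where "Y = mat_adjoint M * X"
  have Y: "Y \<in> carrier_mat n 1" using M X by (simp add: Y_def)
  have "conjugate v \<bullet> (M * mat_adjoint M *\<^sub>v v) = (mat_adjoint X * (M * mat_adjoint M * X)) $$ (0,0)"
    unfolding vX using M X by (intro quadratic_form_index) auto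
  also have "mat_adjoint X * (M * mat_adjoint M * X) = mat_adjoint Y * Y"
    using M X unfolding Y_def mat_adjoint_mult[OF iffD2[OF mat_adjoint_carrier M] X]
    by (simp add: assoc_mult_mat[of _ n n _ n _ 1] assoc_mult_mat[of _ 1 n _ n _ 1])
  also have "(mat_adjoint Y * Y) $$ (0,0) = (\<Sum>l<n. cnj (Y $$ (l,0)) * Y $$ (l,0))"
    using Y by (simp add: index_mult_mat_sum[of _ 1 n _ 1] del: index_mult_mat(1))
  finally show "0 \<le> Re (conjugate v \<bullet> (M * mat_adjoint M *\<^sub>v v))"
    by (simp add: sum_nonneg)
qed

lemma psd_mat_unitary_diag:
  assumes V: "unitary_mat n V" and s: "\<And>i. i < n \<Longrightarrow> 0 \<le> s i"
  shows "psd_mat n (V * mat_diag n (\<lambda>i. complex_of_real (s i)) * mat_adjoint V)"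
proof -
  define R where "R = mat_diag n (\<lambda>i. complex_of_real (sqrt (s i)))"
  have R: "R \<in> carrier_mat n n" "mat_adjoint R = R" by (simp_all add: R_def)
  have "R * R = mat_diag n (\<lambda>i. complex_of_real (s i))"
    unfolding R_def mat_diag_diag by (rule mat_diag_cong) (simp add: s flip: of_real_mult)
  then have "V * mat_diag n (\<lambda>i. complex_of_real (s i)) * mat_adjoint V = (V * R) * mat_adjoint (V * R)"
    using unitary_matD(1)[OF V] R
    by (simp add: mat_adjoint_mult[of _ n n _ n] assoc_mult_mat[of _ n n _ n _ n] flip: \<open>R * R = _\<close>)
  moreover have "V * R \<in> carrier_mat n n" using unitary_matD(1)[OF V] R by simp
  ultimately show ?thesis using psd_mat_mult_adjoint[of "V * R" n] by simp
qed

lemma unitary_conj_diag: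
  assumes V: "unitary_mat n V" and A: "A = V * mat_diag n f * mat_adjoint V"
  shows "mat_adjoint V * A * V = mat_diag n f"
proof -
  note v = unitary_matD[OF V]
  have "mat_adjoint V * A * V = (mat_adjoint V * V) * mat_diag n f * (mat_adjoint V * V)"
    unfolding A using v(1) by (simp add: assoc_mult_mat[of _ n n _ n _ n])
  then show ?thesis
    by (simp add: v(3) left_mult_one_mat[of _ n n] right_mult_one_mat[of _ n n])
qed

text \<open>\<open>f i\<close> is the quadratic form of \<open>A\<close> at column \<open>i\<close>
  of \<open>V\<close>; it is also a diagonal entry of a Hermitian matrix, hence real.\<close>

lemma psd_mat_diag_nonneg:
  assumes psd: "psd_mat n A" and V: "unitary_mat n V" and A: "A = V * mat_diag n f * mat_adjoint V"
    and i: "i < n"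
  shows "0 \<le> Re (f i)" "f i = complex_of_real (Re (f i))"
proof -
  note v = unitary_matD[OF V] and d = unitary_conj_diag[OF V A]
  have cA: "A \<in> carrier_mat n n" and hA: "mat_adjoint A = A"
    using psd by (auto simp: psd_mat_def hermitian_mat_def)
  have "0 \<le> Re (conjugate (col V i) \<bullet> (A *\<^sub>v col V i))"
    using psd v(1) i by (auto simp: psd_mat_def)
  also have "conjugate (col V i) \<bullet> (A *\<^sub>v col V i) = (mat_adjoint V * A * V) $$ (i,i)"
    using quadratic_form_index[OF cA v(1) i] v(1) cA by (simp add: assoc_mult_mat[of _ n n _ n _ n])
  finally show "0 \<le> Re (f i)" using i by (simp add: d)
  have "mat_adjoint (mat_adjoint V * A * V) = mat_adjoint V * A * V"
    using v(1) cA hA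
    by (subst mat_adjoint_mult3[of _ n]) (simp_all add: assoc_mult_mat[of _ n n _ n _ n])
  from arg_cong[OF this, of "\<lambda>M. M $$ (i,i)"] have "cnj (f i) = f i"
    using i unfolding d by simp
  then show "f i = complex_of_real (Re (f i))"
    by (metis Reals_cnj_iff of_real_Re)
qed

section \<open>Spectral decomposition with ordered eigenvalues\<close>

text \<open>The fundamental theorem of algebra; the characteristic polynomial is monic, so no
  leading factor remains.\<close>

lemma char_poly_complex_split:
  assumes A: "(A :: complex mat) \<in> carrier_mat n n" and es: "mset es = proots (char_poly A)"
  shows "char_poly A = (\<Prod>e\<leftarrow>es. [:-e, 1:])"
proof -
  have "char_poly A = (\<Prod>x\<in>#proots (char_poly A). [:-x, 1:])"
    using complex_poly_decompose_multiset[of "char_poly A"] degree_monic_char_poly[OF A] by simp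
  also have "\<dots> = (\<Prod>e\<leftarrow>es. [:-e, 1:])"
    by (simp flip: es prod_mset_prod_list mset_map)
  finally show ?thesis .
qed

text \<open>The spectral theorem is applied twice. The first time, with the roots in any order, it
  shows that they are real, so the real parts listed by \<open>eig_down\<close> are the roots
  themselves; the second time it puts them on the diagonal in decreasing order.\<close>

lemma spectral_psd:
  assumes psd: "psd_mat n A"
  obtains V where "unitary_mat n V"
    "A = V * mat_diag n (\<lambda>i. complex_of_real (eig_down A ! i)) * mat_adjoint V"
    "length (eig_down A) = n" "\<And>i. i < n \<Longrightarrow> 0 \<le> eig_down A ! i"
proof -
  have h: "hermitian_mat n A" and A: "A \<in> carrier_mat n n"
    using psd by (auto simp: psd_mat_def hermitian_mat_def)
  obtain es where es: "mset es = proots (char_poly A)" using ex_mset by blast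
  from spectral_hermitian[OF h char_poly_complex_split[OF A es]]
  obtain V where len: "length es = n" and V: "unitary_mat n V"
    and AV: "A = V * mat_diag n ((!) es) * mat_adjoint V" by auto
  have "map (\<lambda>z. complex_of_real (Re z)) es = es"
    using psd_mat_diag_nonneg(2)[OF psd V AV] len by (intro nth_equalityI) auto
  then have "image_mset (\<lambda>z. complex_of_real (Re z)) (proots (char_poly A)) = proots (char_poly A)"
    by (metis es mset_map)
  moreover have "mset (eig_down A) = image_mset Re (proots (char_poly A))"
    by (simp add: eig_down_def eig_up_def)
  ultimately have es': "mset (map complex_of_real (eig_down A)) = proots (char_poly A)"
    by (simp add: image_mset.compositionality comp_def)
  from spectral_hermitian[OF h char_poly_complex_split[OF A es']]
  obtain V where len: "length (eig_down A) = n" and V: "unitary_mat n V"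
    and AV: "A = V * mat_diag n ((!) (map complex_of_real (eig_down A))) * mat_adjoint V" by auto
  have "mat_diag n ((!) (map complex_of_real (eig_down A))) =
      mat_diag n (\<lambda>i. complex_of_real (eig_down A ! i))"
    using len by (intro mat_diag_cong) simp
  then show ?thesis
    using that[OF V _ len] psd_mat_diag_nonneg(1)[OF psd V AV] AV len by simp
qed

lemma eig_down_antimono: "i \<le> j \<Longrightarrow> j < length (eig_down A) \<Longrightarrow> eig_down A ! j \<le> eig_down A ! i"
  by (simp add: eig_down_def eig_up_def rev_nth sorted_nth_mono)

lemma unitary_diag_square:
  assumes V: "unitary_mat n V"
  shows "(V * mat_diag n f * mat_adjoint V) * (V * mat_diag n g * mat_adjoint V) =
    V * mat_diag n (\<lambda>i. f i * g i) * mat_adjoint V"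
proof -
  note v = unitary_matD[OF V]
  have "(V * mat_diag n f * mat_adjoint V) * (V * mat_diag n g * mat_adjoint V) =
      V * mat_diag n f * (mat_adjoint V * V) * mat_diag n g * mat_adjoint V"
    using v(1) by (simp add: assoc_mult_mat[of _ n n _ n _ n])
  also have "\<dots> = V * (mat_diag n f * mat_diag n g) * mat_adjoint V"
    using v(1) unfolding v(3)
    by (simp add: right_mult_one_mat[of _ n n] assoc_mult_mat[of _ n n _ n _ n] del: mat_diag_diag)
  finally show ?thesis by simp
qed

text \<open>Uniqueness: if \<open>diag(t\<^sup>2)\<close> and \<open>diag(s\<^sup>2)\<close> are intertwined by a matrix \<open>X\<close>, then
  \<open>X\<close> can only be nonzero at entries with \<open>t\<^sub>i = s\<^sub>j\<close>, so it intertwines the square roots, too.\<close>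
lemma psd_sqrt_unitary_diag:
  assumes V: "unitary_mat n V" and s: "\<And>i. i < n \<Longrightarrow> 0 \<le> s i"
  shows "psd_sqrt (V * mat_diag n (\<lambda>i. complex_of_real ((s i)\<^sup>2)) * mat_adjoint V) =
    V * mat_diag n (\<lambda>i. complex_of_real (s i)) * mat_adjoint V" (is "psd_sqrt ?A = ?C")
proof -
  note v = unitary_matD[OF V]
  have dA: "dim_row ?A = n" using v(1) by auto
  have psd: "psd_mat n ?C" by (rule psd_mat_unitary_diag[OF V s])
  have CC: "?C * ?C = ?A"
    by (simp add: unitary_diag_square[OF V] power2_eq_square)
  have uniq: "B = ?C" if B: "psd_mat n B" and BB: "B * B = ?A" for B
  proof -
    obtain W where W: "unitary_mat n W"
      and BW: "B = W * mat_diag n (\<lambda>i. complex_of_real (eig_down B ! i)) * mat_adjoint W"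
      and t: "\<And>i. i < n \<Longrightarrow> 0 \<le> eig_down B ! i"
      using spectral_psd[OF B] by metis
    define t where "t i = eig_down B ! i" for i
    define T where "T = mat_diag n (\<lambda>i. complex_of_real (t i))"
    define T2 where "T2 = mat_diag n (\<lambda>i. complex_of_real ((t i)\<^sup>2))"
    define S where "S = mat_diag n (\<lambda>i. complex_of_real (s i))"
    define S2 where "S2 = mat_diag n (\<lambda>i. complex_of_real ((s i)\<^sup>2))"
    have diags: "T \<in> carrier_mat n n" "T2 \<in> carrier_mat n n" "S \<in> carrier_mat n n" "S2 \<in> carrier_mat n n"
      by (simp_all add: T_def T2_def S_def S2_def)
    note w = unitary_matD[OF W]
    define X where "X = mat_adjoint W * V"
    have X: "X \<in> carrier_mat n n" using w(1) v(1) by (simp add: X_def)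
    have B': "B = W * T * mat_adjoint W" using BW by (simp add: T_def t_def)
    have "W * T2 * mat_adjoint W = V * S2 * mat_adjoint V"
      using BB unfolding B' S2_def T_def unitary_diag_square[OF W] T2_def by (simp add: power2_eq_square)
    then have "mat_adjoint W * (W * T2 * mat_adjoint W) * V = mat_adjoint W * (V * S2 * mat_adjoint V) * V"
      by simp
    moreover have "mat_adjoint W * (W * T2 * mat_adjoint W) * V = (mat_adjoint W * W) * T2 * X"
      using w(1) v(1) diags by (simp add: X_def assoc_mult_mat[of _ n n _ n _ n])
    moreover have "mat_adjoint W * (V * S2 * mat_adjoint V) * V = X * S2 * (mat_adjoint V * V)"
      using w(1) v(1) diags by (simp add: X_def assoc_mult_mat[of _ n n _ n _ n])
    ultimately have eq: "T2 * X = X * S2"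
      using X diags by (simp add: v(3) w(3) right_mult_one_mat[of _ n n])
    have TX: "T * X = X * S"
    proof (rule eq_matI)
      fix i j assume "i < dim_row (X * S)" "j < dim_col (X * S)"
      then have ij: "i < n" "j < n" using X diags by auto
      have "complex_of_real ((t i)\<^sup>2) * X $$ (i,j) = X $$ (i,j) * complex_of_real ((s j)\<^sup>2)"
        using arg_cong[OF eq, of "\<lambda>M. M $$ (i,j)"] ij
        unfolding T2_def S2_def mat_diag_mult_left[OF X] mat_diag_mult_right[OF X] by simp
      then have "X $$ (i,j) = 0 \<or> (t i)\<^sup>2 = (s j)\<^sup>2"
        by (metis mult.commute mult_cancel_left of_real_eq_iff)
      then have "X $$ (i,j) = 0 \<or> t i = s j"
        using t[OF ij(1)] s[OF ij(2)] by (auto simp: t_def)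
      then show "(T * X) $$ (i,j) = (X * S) $$ (i,j)"
        using ij unfolding T_def S_def mat_diag_mult_left[OF X] mat_diag_mult_right[OF X] by auto
    qed (use X diags in auto)
    have "V = W * X"
      using w v(1) by (simp add: X_def flip: assoc_mult_mat[of _ n n _ n _ n])
    \<comment> \<open>With \<open>V = W * X\<close>, then \<open>T * X = X * S\<close>, then X V^* =
      W^*: V S V^* = W X S V^* = W T X V^* = W T W^*.\<close>
    have "?C = W * (X * S) * mat_adjoint V"
      using \<open>V = W * X\<close> w(1) X diags by (simp add: S_def assoc_mult_mat[of _ n n _ n _ n])
    also have "\<dots> = W * T * mat_adjoint W * (V * mat_adjoint V)"
      unfolding TX[symmetric]
      using w(1) v(1) diags by (simp add: X_def assoc_mult_mat[of _ n n _ n _ n])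
    also have "\<dots> = B"
      using w(1) v(1) diags by (simp add: B' v(2) right_mult_one_mat[of _ n n])
    finally show ?thesis by simp
  qed
  show ?thesis
    unfolding psd_sqrt_def dA by (rule the_equality) (use psd CC uniq in blast)+
qed

section \<open>Partial isometries and the trace norm\<close>

text \<open>This class contains the unitaries, which serve for the lower bound, and the matrices
  built from a pseudo-inverse, which attain the maximum even when \<open>M\<close> is
  singular.\<close>

definition partial_isometry :: "nat \<Rightarrow> complex mat \<Rightarrow> bool" where
  "partial_isometry n Y \<longleftrightarrow> Y \<in> carrier_mat n n \<and> Y * mat_adjoint Y * Y = Y"

text \<open>The sum of the singular values. The product is taken in this order because the matrix
  under the root in \<open>fidelity\<close> is a unitary conjugate of M M^*.\<close>

definition trace_norm :: "complex mat \<Rightarrow> real" where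
  "trace_norm M = Re (mtrace (psd_sqrt (M * mat_adjoint M)))"

lemma partial_isometry_unitary: "unitary_mat n U \<Longrightarrow> partial_isometry n U"
  using unitary_matD[of n U] by (simp add: partial_isometry_def)

lemma partial_isometry_adjoint:
  assumes "partial_isometry n Y"
  shows "partial_isometry n (mat_adjoint Y)"
proof -
  have Y: "Y \<in> carrier_mat n n" and YY: "Y * mat_adjoint Y * Y = Y"
    using assms by (auto simp: partial_isometry_def)
  have "mat_adjoint (Y * mat_adjoint Y * Y) = mat_adjoint Y * mat_adjoint (mat_adjoint Y) * mat_adjoint Y"
    using Y by (subst mat_adjoint_mult3[of _ n]) simp_all
  then show ?thesis using Y by (simp add: partial_isometry_def YY)
qed

lemma partial_isometry_mult_unitary:
  assumes "partial_isometry n Y" and T: "unitary_mat n T"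
  shows "partial_isometry n (Y * T)"
proof -
  have Y: "Y \<in> carrier_mat n n" and YY: "Y * mat_adjoint Y * Y = Y"
    using assms by (auto simp: partial_isometry_def)
  note t = unitary_matD[OF T]
  have "Y * T * mat_adjoint (Y * T) * (Y * T) = Y * (T * mat_adjoint T) * mat_adjoint Y * Y * T"
    using Y t(1) by (simp add: mat_adjoint_mult[of _ n n _ n] assoc_mult_mat[of _ n n _ n _ n])
  also have "\<dots> = Y * T"
    using Y by (simp add: t(2) right_mult_one_mat[of _ n n] YY)
  finally show ?thesis using Y t(1) by (simp add: partial_isometry_def)
qed

lemma mult_adjoint_diag_entry:
  assumes "M \<in> carrier_mat n n" "i < n"
  shows "(M * mat_adjoint M) $$ (i,i) = complex_of_real (\<Sum>j<n. (cmod (M $$ (i,j)))\<^sup>2)"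
  unfolding of_real_sum complex_norm_square using assms
  by (simp add: index_mult_mat_sum[of _ n n _ n] del: index_mult_mat(1))

text \<open>P = Y Y^* is an orthogonal projection whose diagonal entry x at \<open>i\<close> is the
  squared norm of row \<open>i\<close> of \<open>Y\<close>. As P = P P^*, x is also the squared norm
  of row \<open>i\<close> of P, which contains the entry x; so x^2 \<le> x.\<close>

lemma partial_isometry_row:
  assumes "partial_isometry n Y" and i: "i < n"
  shows "(\<Sum>j<n. (cmod (Y $$ (i,j)))\<^sup>2) \<le> 1"
proof -
  have Y: "Y \<in> carrier_mat n n" and YY: "Y * mat_adjoint Y * Y = Y"
    using assms by (auto simp: partial_isometry_def)
  define P where "P = Y * mat_adjoint Y"
  have P: "P \<in> carrier_mat n n" using Y by (simp add: P_def)
  have hP: "mat_adjoint P = P" using Y by (simp add: P_def mat_adjoint_mult[of _ n n _ n])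
  have PP: "P * P = P"
    using assoc_mult_mat[of "Y * mat_adjoint Y" n n Y n "mat_adjoint Y" n] Y
    by (simp add: P_def YY)
  define x where "x = (\<Sum>j<n. (cmod (Y $$ (i,j)))\<^sup>2)"
  have Pii: "P $$ (i,i) = complex_of_real x"
    using mult_adjoint_diag_entry[OF Y i] by (simp add: P_def x_def)
  have "x\<^sup>2 = (cmod (P $$ (i,i)))\<^sup>2" unfolding Pii by simp
  also have "\<dots> \<le> (\<Sum>j<n. (cmod (P $$ (i,j)))\<^sup>2)"
    using i by (intro member_le_sum) auto
  also have "\<dots> = x"
    using mult_adjoint_diag_entry[OF P i] unfolding hP PP Pii by (simp only: of_real_eq_iff)
  finally have "x * x \<le> x * 1" by (simp add: power2_eq_square)
  moreover have "0 \<le> x" by (simp add: x_def sum_nonneg)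
  ultimately show ?thesis
    unfolding x_def[symmetric] by (cases "x = 0") (auto simp: mult_le_cancel_left)
qed

lemma partial_isometry_col:
  assumes "partial_isometry n Y" and j: "j < n"
  shows "(\<Sum>i<n. (cmod (Y $$ (i,j)))\<^sup>2) \<le> 1"
proof -
  have "Y \<in> carrier_mat n n" using assms by (simp add: partial_isometry_def)
  then show ?thesis
    using partial_isometry_row[OF partial_isometry_adjoint[OF assms(1)] j] j by simp
qed

lemma partial_isometry_entry:
  assumes "partial_isometry n Y" "i < n" "j < n"
  shows "cmod (Y $$ (i,j)) \<le> 1"
proof -
  have "(cmod (Y $$ (i,j)))\<^sup>2 \<le> (\<Sum>j<n. (cmod (Y $$ (i,j)))\<^sup>2)"
    using assms by (intro member_le_sum) auto
  also have "\<dots> \<le> 1" by (rule partial_isometry_row[OF assms(1,2)])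
  finally show ?thesis by (simp add: power2_le_iff_abs_le abs_square_le_1)
qed

lemma unitary_row_sum:
  assumes U: "unitary_mat n U" and i: "i < n"
  shows "(\<Sum>j<n. (cmod (U $$ (i,j)))\<^sup>2) = 1"
proof -
  note u = unitary_matD[OF U]
  have "complex_of_real (\<Sum>j<n. (cmod (U $$ (i,j)))\<^sup>2) = (U * mat_adjoint U) $$ (i,i)"
    using mult_adjoint_diag_entry[OF u(1) i] by simp
  then have "complex_of_real (\<Sum>j<n. (cmod (U $$ (i,j)))\<^sup>2) = complex_of_real 1"
    using i unfolding u(2) by simp
  then show ?thesis by (simp only: of_real_eq_iff)
qed

lemma unitary_col_sum:
  assumes U: "unitary_mat n U" and j: "j < n"
  shows "(\<Sum>i<n. (cmod (U $$ (i,j)))\<^sup>2) = 1"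
  using unitary_row_sum[OF unitary_mat_adjoint[OF U] j] unitary_matD(1)[OF U] j by simp

section \<open>The variational formula for the trace norm\<close>

text \<open>The \<open>s i\<close> are the singular values of \<open>M\<close>. Conjugation by
  \<open>V\<close> only replaces the eigenbasis \<open>T\<close> by \<open>V * T\<close>, so the
  trace of the root is unchanged; this is the form in which the fidelity appears.\<close>

lemma trace_norm_decomposition:
  assumes M: "M \<in> carrier_mat n n"
  obtains T s where "unitary_mat n T" "\<And>i. i < n \<Longrightarrow> 0 \<le> s i"
    "M * mat_adjoint M = T * mat_diag n (\<lambda>i. complex_of_real ((s i)\<^sup>2)) * mat_adjoint T"
    "\<And>V. unitary_mat n V \<Longrightarrow>
      Re (mtrace (psd_sqrt (V * (M * mat_adjoint M) * mat_adjoint V))) = (\<Sum>i<n. s i)"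
    "trace_norm M = (\<Sum>i<n. s i)"
proof -
  obtain T where T: "unitary_mat n T" and MM: "M * mat_adjoint M =
      T * mat_diag n (\<lambda>i. complex_of_real (eig_down (M * mat_adjoint M) ! i)) * mat_adjoint T"
    and nn: "\<And>i. i < n \<Longrightarrow> 0 \<le> eig_down (M * mat_adjoint M) ! i"
    using spectral_psd[OF psd_mat_mult_adjoint[OF M]] by metis
  note t = unitary_matD[OF T]
  define s where "s i = sqrt (eig_down (M * mat_adjoint M) ! i)" for i
  have s: "0 \<le> s i" if "i < n" for i using nn[OF that] by (simp add: s_def)
  have "mat_diag n (\<lambda>i. complex_of_real (eig_down (M * mat_adjoint M) ! i)) =
      mat_diag n (\<lambda>i. complex_of_real ((s i)\<^sup>2))"
    using nn by (intro mat_diag_cong) (simp add: s_def)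
  then have MM': "M * mat_adjoint M = T * mat_diag n (\<lambda>i. complex_of_real ((s i)\<^sup>2)) * mat_adjoint T"
    using MM by simp
  have tr: "Re (mtrace (psd_sqrt (V * (M * mat_adjoint M) * mat_adjoint V))) = (\<Sum>i<n. s i)"
    if V: "unitary_mat n V" for V
  proof -
    note v = unitary_matD[OF V]
    have VT: "unitary_mat n (V * T)" by (rule unitary_mat_mult[OF V T])
    note vt = unitary_matD[OF VT]
    define S where "S = mat_diag n (\<lambda>i. complex_of_real (s i))"
    have S: "S \<in> carrier_mat n n" by (simp add: S_def)
    have "V * (M * mat_adjoint M) * mat_adjoint V =
        (V * T) * mat_diag n (\<lambda>i. complex_of_real ((s i)\<^sup>2)) * mat_adjoint (V * T)"
      unfolding MM' using v(1) t(1)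
      by (simp add: mat_adjoint_mult[of _ n n _ n] assoc_mult_mat[of _ n n _ n _ n])
    then have "psd_sqrt (V * (M * mat_adjoint M) * mat_adjoint V) = (V * T) * S * mat_adjoint (V * T)"
      by (simp only: psd_sqrt_unitary_diag[OF VT s] S_def)
    then have "mtrace (psd_sqrt (V * (M * mat_adjoint M) * mat_adjoint V)) =
        mtrace (mat_adjoint (V * T) * ((V * T) * S))"
      using mtrace_mult_comm[of "V * T * S" n n "mat_adjoint (V * T)"] vt(1) S by simp
    also have "mat_adjoint (V * T) * ((V * T) * S) = S"
      using vt S assoc_mult_mat[of "mat_adjoint (V * T)" n n "V * T" n S n] by simp
    finally show ?thesis by (simp add: S_def)
  qed
  have "M * mat_adjoint M \<in> carrier_mat n n" using M by simp
  then have "trace_norm M = (\<Sum>i<n. s i)"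
    using tr[OF unitary_mat_one]
    by (simp add: trace_norm_def left_mult_one_mat[of _ n n] right_mult_one_mat[of _ n n])
  with that T s MM' tr show ?thesis by blast
qed

lemma mtrace_mult:
  assumes "A \<in> carrier_mat n m" "B \<in> carrier_mat m n"
  shows "mtrace (A * B) = (\<Sum>i<n. \<Sum>j<m. A $$ (i,j) * B $$ (j,i))"
  using assms by (auto simp: mtrace_def index_mult_mat_sum simp del: index_mult_mat(1) intro!: sum.cong)

text \<open>Inserting T T^* = 1 between \<open>Y\<close> and \<open>M\<close> gives factors
  \<open>Z\<close>, with columns of norm at most 1, and \<open>N\<close>, with rows of norm
  \<open>s j\<close>. Each \<open>j\<close> then contributes at most \<open>s j\<close>, as in
  Cauchy-Schwarz.\<close>

lemma Re_mtrace_le_trace_norm: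
  assumes Y: "partial_isometry n Y" and M: "M \<in> carrier_mat n n"
  shows "Re (mtrace (Y * M)) \<le> trace_norm M"
proof -
  obtain T s where T: "unitary_mat n T" and s: "\<And>i. i < n \<Longrightarrow> 0 \<le> s i"
    and MM: "M * mat_adjoint M = T * mat_diag n (\<lambda>i. complex_of_real ((s i)\<^sup>2)) * mat_adjoint T"
    and tn: "trace_norm M = (\<Sum>i<n. s i)"
    using trace_norm_decomposition[OF M] by metis
  note t = unitary_matD[OF T]
  have cY: "Y \<in> carrier_mat n n" using Y by (simp add: partial_isometry_def)
  define N where "N = mat_adjoint T * M"
  define Z where "Z = Y * T"
  have N: "N \<in> carrier_mat n n" using t(1) M by (simp add: N_def)
  have Z: "Z \<in> carrier_mat n n" using t(1) cY by (simp add: Z_def)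
  have pZ: "partial_isometry n Z" unfolding Z_def by (rule partial_isometry_mult_unitary[OF Y T])
  have "Z * N = Y * (T * mat_adjoint T) * M"
    using cY t(1) M by (simp add: Z_def N_def assoc_mult_mat[of _ n n _ n _ n])
  then have ZN: "Z * N = Y * M" using cY by (simp add: t(2) right_mult_one_mat[of _ n n])
  have "N * mat_adjoint N = mat_adjoint T * (M * mat_adjoint M) * T"
    using t(1) M by (simp add: N_def mat_adjoint_mult[of _ n n _ n] assoc_mult_mat[of _ n n _ n _ n])
  then have NN: "N * mat_adjoint N = mat_diag n (\<lambda>i. complex_of_real ((s i)\<^sup>2))"
    using unitary_conj_diag[OF T MM] by simp
  have row: "(\<Sum>i<n. (cmod (N $$ (j,i)))\<^sup>2) = (s j)\<^sup>2" if "j < n" for j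
  proof -
    have "complex_of_real (\<Sum>i<n. (cmod (N $$ (j,i)))\<^sup>2) = (N * mat_adjoint N) $$ (j,j)"
      by (rule mult_adjoint_diag_entry[OF N that, symmetric])
    also have "\<dots> = complex_of_real ((s j)\<^sup>2)" using that unfolding NN by simp
    finally show ?thesis by (simp only: of_real_eq_iff)
  qed
  have bound: "(\<Sum>i<n. Re (Z $$ (i,j) * N $$ (j,i))) \<le> s j" if j: "j < n" for j
  \<comment> \<open>The weights below divide by \<open>s j\<close>; if it vanishes, so does the
    whole row of \<open>N\<close>.\<close>
  proof (cases "s j = 0")
    case True
    then have "N $$ (j,i) = 0" if "i < n" for i
      using row[OF j] that by (simp add: sum_nonneg_eq_0_iff)
    then show ?thesis using True by simp
  next
    case False
    with s[OF j] have sj: "s j > 0" by simp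
    \<comment> \<open>Weighted arithmetic-geometric mean, with weights chosen so that each of the
      two terms sums to at most \<open>s j / 2\<close>.\<close>
    have "(\<Sum>i<n. Re (Z $$ (i,j) * N $$ (j,i))) \<le>
        (\<Sum>i<n. s j / 2 * (cmod (Z $$ (i,j)))\<^sup>2 + 1 / (2 * s j) * (cmod (N $$ (j,i)))\<^sup>2)"
    proof (rule sum_mono)
      fix i
      define z w where "z = cmod (Z $$ (i,j))" and "w = cmod (N $$ (j,i))"
      have "0 \<le> (s j * z - w)\<^sup>2" by simp
      then have "z * w \<le> s j / 2 * z\<^sup>2 + 1 / (2 * s j) * w\<^sup>2"
        using sj by (simp add: field_simps power2_eq_square)
      moreover have "Re (Z $$ (i,j) * N $$ (j,i)) \<le> z * w"
        unfolding z_def w_def norm_mult[symmetric] by (rule complex_Re_le_cmod)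
      ultimately show "Re (Z $$ (i,j) * N $$ (j,i)) \<le>
          s j / 2 * (cmod (Z $$ (i,j)))\<^sup>2 + 1 / (2 * s j) * (cmod (N $$ (j,i)))\<^sup>2"
        by (simp add: z_def w_def)
    qed
    also have "\<dots> = s j / 2 * (\<Sum>i<n. (cmod (Z $$ (i,j)))\<^sup>2) + 1 / (2 * s j) * (s j)\<^sup>2"
      by (simp add: sum.distrib row[OF j] flip: sum_distrib_left sum_divide_distrib)
    also have "\<dots> \<le> s j / 2 * 1 + 1 / (2 * s j) * (s j)\<^sup>2"
      using partial_isometry_col[OF pZ j] sj by (intro add_right_mono mult_left_mono) auto
    also have "\<dots> = s j" using sj by (simp add: field_simps power2_eq_square)
    finally show ?thesis .
  qed
  have "Re (mtrace (Y * M)) = (\<Sum>i<n. \<Sum>j<n. Re (Z $$ (i,j) * N $$ (j,i)))"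
    unfolding ZN[symmetric] mtrace_mult[OF Z N] by simp
  also have "\<dots> = (\<Sum>j<n. \<Sum>i<n. Re (Z $$ (i,j) * N $$ (j,i)))" by (rule sum.swap)
  also have "\<dots> \<le> (\<Sum>j<n. s j)" by (rule sum_mono) (simp only: bound lessThan_iff)
  finally show ?thesis by (simp only: tn)
qed

text \<open>Writing M = T N with N N^* = diag(s)^2, the maximiser is Y = N^* D T^*, the adjoint of
  the isometric factor in the polar decomposition of \<open>M\<close>. Cyclicity reduces Tr(Y M) to
  Tr(D N N^* ), the sum of the \<open>s i\<close>.\<close>

lemma trace_norm_attained:
  assumes M: "M \<in> carrier_mat n n"
  obtains Y where "partial_isometry n Y" "trace_norm M = Re (mtrace (Y * M))"
proof -
  obtain T s where T: "unitary_mat n T" and s: "\<And>i. i < n \<Longrightarrow> 0 \<le> s i"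
    and MM: "M * mat_adjoint M = T * mat_diag n (\<lambda>i. complex_of_real ((s i)\<^sup>2)) * mat_adjoint T"
    and tn: "trace_norm M = (\<Sum>i<n. s i)"
    using trace_norm_decomposition[OF M] by metis
  note t = unitary_matD[OF T]
  define N where "N = mat_adjoint T * M"
  define S2 where "S2 = mat_diag n (\<lambda>i. complex_of_real ((s i)\<^sup>2))"
  \<comment> \<open>pseudo-inverse of \<open>diag(s)\<close>: entries with \<open>s i = 0\<close> become \<open>1 / 0 = 0\<close>\<close>
  define D where "D = mat_diag n (\<lambda>i. complex_of_real (1 / s i))"
  define Z where "Z = mat_adjoint N * D"
  define Y where "Y = Z * mat_adjoint T"
  have N: "N \<in> carrier_mat n n" using t(1) M by (simp add: N_def)
  have D: "D \<in> carrier_mat n n" "mat_adjoint D = D" and S2: "S2 \<in> carrier_mat n n"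
    by (simp_all add: D_def S2_def)
  have Z: "Z \<in> carrier_mat n n" using N D by (simp add: Z_def)
  have "N * mat_adjoint N = mat_adjoint T * (M * mat_adjoint M) * T"
    using t(1) M by (simp add: N_def mat_adjoint_mult[of _ n n _ n] assoc_mult_mat[of _ n n _ n _ n])
  then have NN: "N * mat_adjoint N = S2"
    using unitary_conj_diag[OF T MM] by (simp add: S2_def)
  have "Z * mat_adjoint Z * Z = mat_adjoint N * (D * D * (N * mat_adjoint N) * D)"
    using N D by (simp add: Z_def mat_adjoint_mult[of _ n n _ n] assoc_mult_mat[of _ n n _ n _ n])
  also have "D * D * (N * mat_adjoint N) * D = D"
    unfolding NN unfolding D_def S2_def mat_diag_diag
    by (rule mat_diag_cong) (simp add: power2_eq_square field_simps)
  finally have "partial_isometry n Z" using Z by (simp add: partial_isometry_def Z_def)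
  then have pY: "partial_isometry n Y"
    unfolding Y_def by (rule partial_isometry_mult_unitary[OF _ unitary_mat_adjoint[OF T]])
  have "Y * M = mat_adjoint N * (D * N)"
    using N D t(1) M by (simp add: Y_def Z_def N_def assoc_mult_mat[of _ n n _ n _ n])
  then have "mtrace (Y * M) = mtrace (D * N * mat_adjoint N)"
    using mtrace_mult_comm[of "mat_adjoint N" n n "D * N"] N D by simp
  also have "D * N * mat_adjoint N = D * S2"
    using N D by (simp add: assoc_mult_mat[of _ n n _ n _ n] NN)
  also have "\<dots> = mat_diag n (\<lambda>i. complex_of_real (s i))"
    unfolding D_def S2_def mat_diag_diag by (rule mat_diag_cong) (simp add: power2_eq_square)
  finally have "trace_norm M = Re (mtrace (Y * M))" by (simp add: tn)
  with pY show ?thesis by (rule that)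
qed

text \<open>A maximiser \<open>Y\<close> for \<open>M\<close> also competes for \<open>N\<close>, so
  the difference is at most Re Tr(Y (M - N)); the entries of \<open>Y\<close> have modulus at most
  1.\<close>

lemma trace_norm_diff_le:
  assumes M: "M \<in> carrier_mat n n" and N: "N \<in> carrier_mat n n"
  shows "trace_norm M - trace_norm N \<le> (\<Sum>i<n. \<Sum>j<n. cmod (M $$ (i,j) - N $$ (i,j)))"
proof -
  obtain Y where Y: "partial_isometry n Y" and tn: "trace_norm M = Re (mtrace (Y * M))"
    by (rule trace_norm_attained[OF M])
  have cY: "Y \<in> carrier_mat n n" using Y by (simp add: partial_isometry_def)
  have "trace_norm M - trace_norm N \<le> Re (mtrace (Y * M)) - Re (mtrace (Y * N))"
    using Re_mtrace_le_trace_norm[OF Y N] tn by simp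
  also have "\<dots> = (\<Sum>i<n. \<Sum>j<n. Re (Y $$ (i,j) * (M $$ (j,i) - N $$ (j,i))))"
    by (simp add: mtrace_mult[OF cY M] mtrace_mult[OF cY N] algebra_simps flip: sum_subtractf)
  also have "\<dots> \<le> (\<Sum>i<n. \<Sum>j<n. cmod (M $$ (j,i) - N $$ (j,i)))"
  proof (intro sum_mono)
    fix i j assume "i \<in> {..<n}" "j \<in> {..<n}"
    then have "cmod (Y $$ (i,j)) \<le> 1" using partial_isometry_entry[OF Y] by simp
    then have "cmod (Y $$ (i,j) * (M $$ (j,i) - N $$ (j,i))) \<le> cmod (M $$ (j,i) - N $$ (j,i))"
      unfolding norm_mult by (intro mult_left_le_one_le) auto
    then show "Re (Y $$ (i,j) * (M $$ (j,i) - N $$ (j,i))) \<le> cmod (M $$ (j,i) - N $$ (j,i))"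
      using complex_Re_le_cmod order_trans by blast
  qed
  also have "\<dots> = (\<Sum>i<n. \<Sum>j<n. cmod (M $$ (i,j) - N $$ (i,j)))" by (rule sum.swap)
  finally show ?thesis .
qed

section \<open>Rearrangement inequalities\<close>

text \<open>Linear programming duality: with \<open>a n = 0\<close> and \<open>\<delta> k = a k - a (k + 1)\<close>, the weights
  \<open>u i = (\<Sum>k\<ge>i. \<delta> k * b k)\<close> and \<open>v j = (\<Sum>k\<ge>j. \<delta> k * (b j - b k))\<close> are nonnegative and
  satisfy \<open>u i + v j \<ge> a i * b j\<close>, with equality for \<open>i = j\<close>.\<close>
lemma substochastic_rearrangement:
  fixes a b :: "nat \<Rightarrow> real"
  assumes a: "\<And>i j. i \<le> j \<Longrightarrow> j < n \<Longrightarrow> a j \<le> a i" and a0: "\<And>i. i < n \<Longrightarrow> 0 \<le> a i"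
    and b: "\<And>i j. i \<le> j \<Longrightarrow> j < n \<Longrightarrow> b j \<le> b i" and b0: "\<And>i. i < n \<Longrightarrow> 0 \<le> b i"
    and D: "\<And>i j. i < n \<Longrightarrow> j < n \<Longrightarrow> 0 \<le> D i j"
    and row: "\<And>i. i < n \<Longrightarrow> (\<Sum>j<n. D i j) \<le> 1"
    and col: "\<And>j. j < n \<Longrightarrow> (\<Sum>i<n. D i j) \<le> 1"
  shows "(\<Sum>i<n. \<Sum>j<n. a i * b j * D i j) \<le> (\<Sum>i<n. a i * b i)"
proof -
  define a' where "a' k = (if k < n then a k else 0)" for k
  define \<delta> where "\<delta> k = a' k - a' (Suc k)" for k
  define u where "u i = (\<Sum>k=i..<n. \<delta> k * b k)" for i
  define v where "v j = (\<Sum>k=j..<n. \<delta> k * (b j - b k))" for j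
  have \<delta>: "0 \<le> \<delta> k" if "k < n" for k
    using a[of k "Suc k"] a0[of k] that by (auto simp: \<delta>_def a'_def)
  have tele: "(\<Sum>k=i..<n. \<delta> k) = a i" if "i < n" for i
  proof -
    have "(\<Sum>k=i..<n. \<delta> k) = - (\<Sum>k=i..<n. a' (Suc k) - a' k)"
      by (simp add: \<delta>_def flip: sum_negf)
    also have "\<dots> = a i" using that by (subst sum_Suc_diff') (auto simp: a'_def)
    finally show ?thesis .
  qed
  have u: "0 \<le> u i" if "i < n" for i
    unfolding u_def using \<delta> b0 by (intro sum_nonneg mult_nonneg_nonneg) auto
  have v: "0 \<le> v j" if "j < n" for j
    unfolding v_def using \<delta> b by (intro sum_nonneg mult_nonneg_nonneg) auto
  have ab: "a i * b j = (\<Sum>k=i..<n. \<delta> k * b j)" if "i < n" for i j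
    by (simp only: tele[OF that, symmetric] sum_distrib_right)
  \<comment> \<open>The slack is the sum of \<open>\<delta> k\<close> times the distance of
    \<open>b k\<close> and \<open>b j\<close>, over \<open>k\<close> from the smaller of
    \<open>i\<close> and \<open>j\<close> to just below the larger.\<close>
  have uv: "a i * b j \<le> u i + v j" if i: "i < n" and j: "j < n" for i j
  proof (cases "i \<le> j")
    case True
    have split: "(\<Sum>k=i..<n. f k) = (\<Sum>k=i..<j. f k) + (\<Sum>k=j..<n. f k)" for f :: "nat \<Rightarrow> real"
      using True j by (simp add: sum.atLeastLessThan_concat)
    have "0 \<le> (\<Sum>k=i..<j. \<delta> k * (b k - b j))"
      using \<delta> b j by (intro sum_nonneg mult_nonneg_nonneg) auto
    also have "\<dots> = u i + v j - a i * b j"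
      unfolding ab[OF i] u_def v_def
      by (simp add: split[of "\<lambda>k. \<delta> k * b k"] split[of "\<lambda>k. \<delta> k * b j"]
          right_diff_distrib sum_subtractf)
    finally show ?thesis by simp
  next
    case False
    have split: "(\<Sum>k=j..<n. f k) = (\<Sum>k=j..<i. f k) + (\<Sum>k=i..<n. f k)" for f :: "nat \<Rightarrow> real"
      using False i by (simp add: sum.atLeastLessThan_concat)
    have "0 \<le> (\<Sum>k=j..<i. \<delta> k * (b j - b k))"
      using \<delta> b i by (intro sum_nonneg mult_nonneg_nonneg) auto
    also have "\<dots> = u i + v j - a i * b j"
      unfolding ab[OF i] u_def v_def split by (simp add: right_diff_distrib sum_subtractf)
    finally show ?thesis by simp
  qed
  have uv_eq: "u i + v i = a i * b i" if "i < n" for i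
    unfolding ab[OF that] u_def v_def by (simp add: right_diff_distrib sum_subtractf)
  \<comment> \<open>Weak duality: since \<open>u\<close> and \<open>v\<close> are nonnegative, the
    row and column sums of \<open>D\<close> may be raised to 1.\<close>
  have "(\<Sum>i<n. \<Sum>j<n. a i * b j * D i j) \<le> (\<Sum>i<n. \<Sum>j<n. (u i + v j) * D i j)"
    using uv D by (intro sum_mono mult_right_mono) auto
  also have "\<dots> = (\<Sum>i<n. \<Sum>j<n. u i * D i j) + (\<Sum>j<n. \<Sum>i<n. v j * D i j)"
    by (subst (3) sum.swap) (simp add: distrib_right sum.distrib)
  also have "\<dots> = (\<Sum>i<n. u i * (\<Sum>j<n. D i j)) + (\<Sum>j<n. v j * (\<Sum>i<n. D i j))"
    by (simp only: sum_distrib_left)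
  also have "\<dots> \<le> (\<Sum>i<n. u i * 1) + (\<Sum>j<n. v j * 1)"
    using u v row col by (intro add_mono sum_mono mult_left_mono) auto
  also have "\<dots> = (\<Sum>i<n. a i * b i)"
    by (simp add: uv_eq flip: sum.distrib)
  finally show ?thesis .
qed

text \<open>The upper bound is applied to \<open>c\<close>, which is \<open>b\<close> reversed and
  subtracted from its largest value, together with \<open>D\<close> with reversed columns. The
  constant \<open>K\<close> contributes the same to both sides because the rows of \<open>D\<close>
  sum to exactly 1.\<close>

lemma doubly_stochastic_rearrangement_ge:
  fixes a b :: "nat \<Rightarrow> real"
  assumes a: "\<And>i j. i \<le> j \<Longrightarrow> j < n \<Longrightarrow> a j \<le> a i" and a0: "\<And>i. i < n \<Longrightarrow> 0 \<le> a i"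
    and b: "\<And>i j. i \<le> j \<Longrightarrow> j < n \<Longrightarrow> b j \<le> b i"
    and D: "\<And>i j. i < n \<Longrightarrow> j < n \<Longrightarrow> 0 \<le> D i j"
    and row: "\<And>i. i < n \<Longrightarrow> (\<Sum>j<n. D i j) = 1"
    and col: "\<And>j. j < n \<Longrightarrow> (\<Sum>i<n. D i j) = 1"
  shows "(\<Sum>i<n. a i * b (n - Suc i)) \<le> (\<Sum>i<n. \<Sum>j<n. a i * b j * D i j)"
proof -
  define K where "K = b 0"
  define c where "c j = K - b (n - Suc j)" for j
  have rev: "(\<Sum>j<n. D i (n - Suc j)) = (\<Sum>j<n. D i j)" for i
    by (rule sum.nat_diff_reindex)
  have "(\<Sum>i<n. \<Sum>j<n. a i * c j * D i (n - Suc j)) \<le> (\<Sum>i<n. a i * c i)"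
  proof (rule substochastic_rearrangement[OF a a0])
    show "c j \<le> c i" if "i \<le> j" "j < n" for i j
      using b[of "n - Suc j" "n - Suc i"] that by (simp add: c_def)
    show "0 \<le> c i" if "i < n" for i
      using b[of 0 "n - Suc i"] that by (simp add: c_def K_def)
  qed (use D row col rev in auto)
  also have "(\<Sum>i<n. \<Sum>j<n. a i * c j * D i (n - Suc j)) = (\<Sum>i<n. \<Sum>j<n. a i * (K - b j) * D i j)"
  proof (rule sum.cong[OF refl])
    fix i
    have "(\<Sum>j<n. a i * c j * D i (n - Suc j)) = (\<Sum>j<n. a i * (K - b (n - Suc j)) * D i (n - Suc j))"
      by (simp add: c_def)
    also have "\<dots> = (\<Sum>j<n. a i * (K - b j) * D i j)"
      by (rule sum.nat_diff_reindex)
    finally show "(\<Sum>j<n. a i * c j * D i (n - Suc j)) = (\<Sum>j<n. a i * (K - b j) * D i j)" .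
  qed
  also have "\<dots> = (\<Sum>i<n. a i * K * (\<Sum>j<n. D i j)) - (\<Sum>i<n. \<Sum>j<n. a i * b j * D i j)"
    by (simp add: algebra_simps sum_subtractf sum_distrib_left)
  also have "(\<Sum>i<n. a i * K * (\<Sum>j<n. D i j)) = (\<Sum>i<n. a i * K)"
    by (simp add: row)
  also have "(\<Sum>i<n. a i * c i) = (\<Sum>i<n. a i * K) - (\<Sum>i<n. a i * b (n - Suc i))"
    by (simp add: c_def algebra_simps sum_subtractf)
  finally show ?thesis by simp
qed

section \<open>Unitary orbits\<close>

definition sandwich :: "nat \<Rightarrow> (nat \<Rightarrow> real) \<Rightarrow> (nat \<Rightarrow> real) \<Rightarrow> complex mat \<Rightarrow> complex mat" where
  "sandwich n a b X =
    mat_diag n (\<lambda>i. complex_of_real (a i)) * X * mat_diag n (\<lambda>i. complex_of_real (b i))"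

lemma sandwich_carrier [simp]: "X \<in> carrier_mat n n \<Longrightarrow> sandwich n a b X \<in> carrier_mat n n"
  by (simp add: sandwich_def)

lemma sandwich_index:
  assumes X: "X \<in> carrier_mat n n" and "i < n" "j < n"
  shows "sandwich n a b X $$ (i,j) = a i * X $$ (i,j) * b j"
  using assms unfolding sandwich_def mat_diag_mult_left[OF X]
  by (subst mat_diag_mult_right[of _ n]) auto

section \<open>Two-sided bounds for the trace norm\<close>

lemma trace_norm_sandwich_le:
  assumes a: "\<And>i j. i \<le> j \<Longrightarrow> j < n \<Longrightarrow> a j \<le> a i" and a0: "\<And>i. i < n \<Longrightarrow> 0 \<le> a i"
    and b: "\<And>i j. i \<le> j \<Longrightarrow> j < n \<Longrightarrow> b j \<le> b i" and b0: "\<And>i. i < n \<Longrightarrow> 0 \<le> b i"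
    and X: "unitary_mat n X"
  shows "trace_norm (sandwich n a b X) \<le> (\<Sum>i<n. a i * b i)"
proof -
  note x = unitary_matD[OF X]
  obtain Y where Y: "partial_isometry n Y"
    and tn: "trace_norm (sandwich n a b X) = Re (mtrace (Y * sandwich n a b X))"
    by (rule trace_norm_attained[OF sandwich_carrier[OF x(1)]])
  have cY: "Y \<in> carrier_mat n n" using Y by (simp add: partial_isometry_def)
  \<comment> \<open>The mean of the squared moduli of \<open>X\<close> and of the transpose of
    \<open>Y\<close>. Unitarity of \<open>X\<close> and the row and column bounds for
    \<open>Y\<close> make it doubly substochastic.\<close>
  define D where "D i j = ((cmod (X $$ (i,j)))\<^sup>2 + (cmod (Y $$ (j,i)))\<^sup>2) / 2" for i j
  have "trace_norm (sandwich n a b X) =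
      (\<Sum>j<n. \<Sum>i<n. Re (Y $$ (j,i) * (a i * X $$ (i,j) * b j)))"
    unfolding tn mtrace_mult[OF cY sandwich_carrier[OF x(1)]]
    by (simp add: sandwich_index[OF x(1)])
  also have "\<dots> = (\<Sum>i<n. \<Sum>j<n. Re (Y $$ (j,i) * (a i * X $$ (i,j) * b j)))"
    by (rule sum.swap)
  also have "\<dots> \<le> (\<Sum>i<n. \<Sum>j<n. a i * b j * D i j)"
  proof (intro sum_mono)
    fix i j assume "i \<in> {..<n}" "j \<in> {..<n}"
    then have ab: "0 \<le> a i * b j" using a0 b0 by simp
    have "Re (Y $$ (j,i) * (a i * X $$ (i,j) * b j)) = a i * b j * Re (Y $$ (j,i) * X $$ (i,j))"
      by (simp add: algebra_simps)
    also have "\<dots> \<le> a i * b j * (cmod (Y $$ (j,i)) * cmod (X $$ (i,j)))"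
      unfolding norm_mult[symmetric] by (intro mult_left_mono complex_Re_le_cmod ab)
    also have "\<dots> \<le> a i * b j * D i j"
    proof (rule mult_left_mono[OF _ ab])
      have "0 \<le> (cmod (X $$ (i,j)) - cmod (Y $$ (j,i)))\<^sup>2" by simp
      then show "cmod (Y $$ (j,i)) * cmod (X $$ (i,j)) \<le> D i j"
        by (simp add: D_def power2_diff algebra_simps)
    qed
    finally show "Re (Y $$ (j,i) * (a i * X $$ (i,j) * b j)) \<le> a i * b j * D i j" .
  qed
  also have "\<dots> \<le> (\<Sum>i<n. a i * b i)"
  proof (rule substochastic_rearrangement[OF a a0 b b0])
    show "0 \<le> D i j" for i j by (simp add: D_def)
    show "(\<Sum>j<n. D i j) \<le> 1" if "i < n" for i
      using unitary_row_sum[OF X that] partial_isometry_col[OF Y that]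
      by (simp add: D_def sum.distrib flip: sum_divide_distrib)
    show "(\<Sum>i<n. D i j) \<le> 1" if "j < n" for j
      using unitary_col_sum[OF X that] partial_isometry_row[OF Y that]
      by (simp add: D_def sum.distrib flip: sum_divide_distrib)
  qed
  finally show ?thesis .
qed

text \<open>The adjoint of \<open>X\<close> competes in the variational formula, and its trace is
  the bilinear form of \<open>a\<close> and \<open>b\<close> with the squared moduli of
  \<open>X\<close>, a doubly stochastic matrix.\<close>

lemma trace_norm_sandwich_ge:
  assumes a: "\<And>i j. i \<le> j \<Longrightarrow> j < n \<Longrightarrow> a j \<le> a i" and a0: "\<And>i. i < n \<Longrightarrow> 0 \<le> a i"
    and b: "\<And>i j. i \<le> j \<Longrightarrow> j < n \<Longrightarrow> b j \<le> b i"
    and X: "unitary_mat n X"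
  shows "(\<Sum>i<n. a i * b (n - Suc i)) \<le> trace_norm (sandwich n a b X)"
proof -
  note x = unitary_matD[OF X]
  have "(\<Sum>i<n. a i * b (n - Suc i)) \<le> (\<Sum>i<n. \<Sum>j<n. a i * b j * (cmod (X $$ (i,j)))\<^sup>2)"
    by (rule doubly_stochastic_rearrangement_ge[OF a a0 b])
      (simp_all add: unitary_row_sum[OF X] unitary_col_sum[OF X])
  also have "\<dots> = (\<Sum>j<n. \<Sum>i<n. a i * b j * (cmod (X $$ (i,j)))\<^sup>2)" by (rule sum.swap)
  also have "\<dots> = (\<Sum>j<n. \<Sum>i<n. Re (mat_adjoint X $$ (j,i) * sandwich n a b X $$ (i,j)))"
    unfolding cmod_power2 using x(1)
    by (intro sum.cong) (auto simp: sandwich_index algebra_simps power2_eq_square)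
  also have "\<dots> = Re (mtrace (mat_adjoint X * sandwich n a b X))"
    using x(1) by (subst mtrace_mult[of _ n n]) simp_all
  also have "\<dots> \<le> trace_norm (sandwich n a b X)"
    by (rule Re_mtrace_le_trace_norm[OF partial_isometry_unitary[OF unitary_mat_adjoint[OF X]]])
      (simp add: x(1))
  finally show ?thesis .
qed

section \<open>The endpoints and a path between them\<close>

text \<open>Each row of M has its only possibly nonzero entry in column \<open>r i\<close>, and
  these columns are distinct, so M M^* is diagonal. The identity and the reversal give the two ends
  of the interval.\<close>

lemma trace_norm_sandwich_permutation:
  assumes r: "\<And>i. i < n \<Longrightarrow> r i < n" and inj: "inj_on r {..<n}"
    and a0: "\<And>i. i < n \<Longrightarrow> 0 \<le> a i" and b0: "\<And>i. i < n \<Longrightarrow> 0 \<le> b i"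
  shows "trace_norm (sandwich n a b (mat n n (\<lambda>(i,j). of_bool (j = r i)))) = (\<Sum>i<n. a i * b (r i))"
    (is "trace_norm (sandwich n a b ?X) = _")
proof -
  define M where "M = sandwich n a b ?X"
  have M: "M \<in> carrier_mat n n" by (simp add: M_def)
  have ent: "M $$ (i,j) = (if j = r i then complex_of_real (a i * b j) else 0)" if "i < n" "j < n" for i j
    using that by (simp add: M_def sandwich_index)
  have s: "0 \<le> a i * b (r i)" if "i < n" for i using that a0 b0 r by simp
  have "M * mat_adjoint M = mat_diag n (\<lambda>i. complex_of_real ((a i * b (r i))\<^sup>2))"
  proof (rule eq_matI)
    fix i j
    assume "i < dim_row (mat_diag n (\<lambda>i. complex_of_real ((a i * b (r i))\<^sup>2)))"
      "j < dim_col (mat_diag n (\<lambda>i. complex_of_real ((a i * b (r i))\<^sup>2)))"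
    then have ij: "i < n" "j < n" by auto
    have "(M * mat_adjoint M) $$ (i,j) = (\<Sum>k<n. M $$ (i,k) * cnj (M $$ (j,k)))"
      using M ij by (simp add: index_mult_mat_sum[of _ n n _ n] del: index_mult_mat(1))
    also have "\<dots> = (\<Sum>k<n. if k = r i then complex_of_real (a i * b k) * cnj (M $$ (j,k)) else 0)"
      using ij by (intro sum.cong) (auto simp: ent)
    also have "\<dots> = complex_of_real (a i * b (r i)) * cnj (M $$ (j,r i))"
      using r[OF ij(1)] by simp
    also have "\<dots> = mat_diag n (\<lambda>i. complex_of_real ((a i * b (r i))\<^sup>2)) $$ (i,j)"
      using ij r inj_on_eq_iff[OF inj, of i j] by (auto simp: ent power2_eq_square)
    finally show "(M * mat_adjoint M) $$ (i,j) =
      mat_diag n (\<lambda>i. complex_of_real ((a i * b (r i))\<^sup>2)) $$ (i,j)" .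
  qed (use M in auto)
  then have "psd_sqrt (M * mat_adjoint M) = mat_diag n (\<lambda>i. complex_of_real (a i * b (r i)))"
    using psd_sqrt_unitary_diag[OF unitary_mat_one s]
    by (simp add: left_mult_one_mat[of _ n n] right_mult_one_mat[of _ n n])
  then show ?thesis by (simp add: trace_norm_def flip: M_def)
qed

text \<open>With \<open>P\<close> the reversal permutation, which is a Hermitian involution, this is the unitary
  \<open>(1 + e\<^sup>i\<^sup>t)/2 + (1 - e\<^sup>i\<^sup>t)/2 P\<close>, acting as \<open>1\<close> and \<open>e\<^sup>i\<^sup>t\<close> on the eigenspaces
  of \<open>P\<close>; it connects the identity (\<open>t = 0\<close>) to \<open>P\<close> (\<open>t = \<pi>\<close>).\<close>
definition reversal_path :: "nat \<Rightarrow> real \<Rightarrow> complex mat" where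
  "reversal_path n t = mat n n (\<lambda>(i,j).
    (1 + cis t) / 2 * of_bool (j = i) + (1 - cis t) / 2 * of_bool (j = n - Suc i))"

lemma reversal_path_carrier [simp]: "reversal_path n t \<in> carrier_mat n n"
  by (simp add: reversal_path_def)

lemma reversal_path_unitary: "unitary_mat n (reversal_path n t)"
proof -
  define c s where "c = (1 + cis t) / 2" and "s = (1 - cis t) / 2"
  \<comment> \<open>For an involution P these are the coefficients of 1 and P in the product of c +
    s P with its adjoint.\<close>
  have cs: "c * cnj c + s * cnj s = 1" "c * cnj s + s * cnj c = 0"
    unfolding c_def s_def by (simp_all add: field_simps cis_cnj cis_mult)
  define X where "X = reversal_path n t"
  have X: "X \<in> carrier_mat n n" by (simp add: X_def)
  have ent: "X $$ (i,j) = c * of_bool (j = i) + s * of_bool (j = n - Suc i)" if "i < n" "j < n" for i j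
    using that by (simp add: X_def reversal_path_def c_def s_def)
  have "X * mat_adjoint X = 1\<^sub>m n"
  proof (rule eq_matI)
    fix i j assume "i < dim_row (1\<^sub>m n :: complex mat)" "j < dim_col (1\<^sub>m n :: complex mat)"
    then have ij: "i < n" "j < n" by auto
    have "(X * mat_adjoint X) $$ (i,j) = (\<Sum>k<n. X $$ (i,k) * cnj (X $$ (j,k)))"
      using X ij by (simp add: index_mult_mat_sum[of _ n n _ n] del: index_mult_mat(1))
    \<comment> \<open>Two separate conditional terms, so that the middle index, where
      \<open>i = n - Suc i\<close>, receives both contributions without a case distinction.\<close>
    also have "\<dots> = (\<Sum>k<n. (if k = i then c * cnj (X $$ (j,k)) else 0) +
        (if k = n - Suc i then s * cnj (X $$ (j,k)) else 0))"
      using ij by (intro sum.cong) (auto simp: ent algebra_simps)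
    also have "\<dots> = c * cnj (X $$ (j,i)) + s * cnj (X $$ (j,n - Suc i))"
      using ij by (simp add: sum.distrib)
    also have "\<dots> = (c * cnj c + s * cnj s) * of_bool (i = j) +
        (c * cnj s + s * cnj c) * of_bool (i = n - Suc j)"
    proof -
      have "n - Suc i = j \<longleftrightarrow> i = n - Suc j" "n - Suc i = n - Suc j \<longleftrightarrow> i = j" using ij by auto
      then show ?thesis using ij by (simp add: ent algebra_simps)
    qed
    also have "\<dots> = 1\<^sub>m n $$ (i,j)" using ij by (simp add: cs)
    finally show "(X * mat_adjoint X) $$ (i,j) = 1\<^sub>m n $$ (i,j)" .
  qed (use X in auto)
  then show ?thesis using X by (simp add: unitary_mat_def X_def)
qed

text \<open>The Lipschitz estimate, used in both directions, bounds the change of the trace norm by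
  \<open>g\<close>, which tends to 0 because every entry is continuous in the parameter.\<close>

lemma continuous_trace_norm_reversal_path:
  "isCont (\<lambda>t. trace_norm (sandwich n a b (reversal_path n t))) t"
proof -
  define M where "M t = sandwich n a b (reversal_path n t)" for t
  define g where "g t' = (\<Sum>i<n. \<Sum>j<n. cmod (M t' $$ (i,j) - M t $$ (i,j)))" for t'
  have M: "M t \<in> carrier_mat n n" for t by (simp add: M_def)
  have ent: "M t $$ (i,j) = a i * ((1 + cis t) / 2 * of_bool (j = i) +
      (1 - cis t) / 2 * of_bool (j = n - Suc i)) * b j" if "i < n" "j < n" for t i j
    using that by (simp add: M_def sandwich_index reversal_path_def)
  have cis: "isCont cis t" unfolding cis_conv_exp by (intro continuous_intros)
  have "isCont (\<lambda>t'. M t' $$ (i,j)) t" if "i < n" "j < n" for i j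
    unfolding ent[OF that] using cis by (intro continuous_intros) auto
  then have "isCont g t"
    unfolding g_def by (intro continuous_intros) auto
  then have g: "g \<midarrow>t\<rightarrow> 0" by (simp add: isCont_def g_def)
  have le: "dist (trace_norm (M t')) (trace_norm (M t)) \<le> dist (g t') 0" for t'
    using trace_norm_diff_le[OF M M, of t' t] trace_norm_diff_le[OF M M, of t t']
    by (simp add: g_def dist_real_def norm_minus_commute sum_nonneg)
  show ?thesis
    unfolding isCont_def M_def[symmetric]
    by (rule metric_tendsto_imp_tendsto[OF g]) (simp only: le eventually_True)
qed

lemma trace_norm_sandwich_range:
  assumes a: "\<And>i j. i \<le> j \<Longrightarrow> j < n \<Longrightarrow> a j \<le> a i" and a0: "\<And>i. i < n \<Longrightarrow> 0 \<le> a i"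
    and b: "\<And>i j. i \<le> j \<Longrightarrow> j < n \<Longrightarrow> b j \<le> b i" and b0: "\<And>i. i < n \<Longrightarrow> 0 \<le> b i"
  shows "{trace_norm (sandwich n a b X) | X. unitary_mat n X} =
    {(\<Sum>i<n. a i * b (n - Suc i)) .. (\<Sum>i<n. a i * b i)}"
proof (intro equalityI subsetI)
  fix y assume "y \<in> {trace_norm (sandwich n a b X) | X. unitary_mat n X}"
  then show "y \<in> {(\<Sum>i<n. a i * b (n - Suc i)) .. (\<Sum>i<n. a i * b i)}"
    using trace_norm_sandwich_le[OF a a0 b b0] trace_norm_sandwich_ge[OF a a0 b] by auto
next
  fix y assume y: "y \<in> {(\<Sum>i<n. a i * b (n - Suc i)) .. (\<Sum>i<n. a i * b i)}"
  define f where "f t = trace_norm (sandwich n a b (reversal_path n t))" for t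
  have "reversal_path n 0 = mat n n (\<lambda>(i,j). of_bool (j = i))"
    by (auto simp: reversal_path_def intro!: eq_matI)
  then have f0: "f 0 = (\<Sum>i<n. a i * b i)"
    using trace_norm_sandwich_permutation[where n = n and r = "\<lambda>i. i" and a = a and b = b] a0 b0 by (simp add: f_def)
  have "reversal_path n pi = mat n n (\<lambda>(i,j). of_bool (j = n - Suc i))"
    by (auto simp: reversal_path_def intro!: eq_matI)
  moreover have "inj_on (\<lambda>i. n - Suc i) {..<n}" by (auto simp: inj_on_def)
  ultimately have fpi: "f pi = (\<Sum>i<n. a i * b (n - Suc i))"
    using trace_norm_sandwich_permutation[where n = n and r = "\<lambda>i. n - Suc i" and a = a and b = b] a0 b0 by (simp add: f_def)
  \<comment> \<open>\<open>IVT2\<close> is the form for a larger value at the left end: the path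
    starts at the maximum and ends at the minimum.\<close>
  have "\<exists>t. 0 \<le> t \<and> t \<le> pi \<and> f t = y"
    using y f0 fpi continuous_trace_norm_reversal_path[where n = n and a = a and b = b]
    by (intro IVT2) (auto simp: f_def)
  then show "y \<in> {trace_norm (sandwich n a b X) | X. unitary_mat n X}"
    using reversal_path_unitary[of n] by (auto simp: f_def)
qed

section \<open>Reduction of the fidelity to the trace norm\<close>

text \<open>In the eigenbases the matrix under the root equals V M M^* V^* for the sandwiched matrix
  M, and the outer \<open>V\<close> does not affect the trace of the root.\<close>

lemma fidelity_unitary_diag:
  assumes V: "unitary_mat n V" and W: "unitary_mat n W" and U: "unitary_mat n U"
    and a0: "\<And>i. i < n \<Longrightarrow> 0 \<le> a i"
    and \<rho>: "\<rho> = V * mat_diag n (\<lambda>i. complex_of_real ((a i)\<^sup>2)) * mat_adjoint V"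
    and \<sigma>: "\<sigma> = W * mat_diag n (\<lambda>i. complex_of_real ((b i)\<^sup>2)) * mat_adjoint W"
  shows "fidelity \<rho> (U * \<sigma> * mat_adjoint U) = trace_norm (sandwich n a b (mat_adjoint V * U * W))"
proof -
  note v = unitary_matD[OF V] and w = unitary_matD[OF W] and u = unitary_matD[OF U]
  define A where "A = mat_diag n (\<lambda>i. complex_of_real (a i))"
  define B where "B = mat_diag n (\<lambda>i. complex_of_real (b i))"
  define M where "M = sandwich n a b (mat_adjoint V * U * W)"
  have A: "A \<in> carrier_mat n n" "mat_adjoint A = A" and B: "B \<in> carrier_mat n n" "mat_adjoint B = B"
    by (simp_all add: A_def B_def)
  have MA: "M = A * (mat_adjoint V * U * W) * B" by (simp add: M_def sandwich_def A_def B_def)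
  have M: "M \<in> carrier_mat n n"
    unfolding MA using v(1) w(1) u(1) A(1) B(1) by (intro mult_carrier_mat[of _ n n _ n]) simp_all
  have sqrt: "psd_sqrt \<rho> = V * A * mat_adjoint V"
    unfolding \<rho> A_def by (rule psd_sqrt_unitary_diag[OF V a0])
  have BB: "mat_diag n (\<lambda>i. complex_of_real ((b i)\<^sup>2)) = B * B"
    unfolding B_def mat_diag_diag by (rule mat_diag_cong) (simp add: power2_eq_square)
  have Ma: "mat_adjoint M = B * (mat_adjoint W * mat_adjoint U * V) * A"
  proof -
    have "mat_adjoint V * U * W \<in> carrier_mat n n"
      using v(1) w(1) u(1) by simp
    moreover have "mat_adjoint (mat_adjoint V * U * W) = mat_adjoint W * mat_adjoint U * V"
      using mat_adjoint_mult3[of "mat_adjoint V" n U W] v(1) w(1) u(1) by simp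
    ultimately show ?thesis
      using mat_adjoint_mult3[of A n "mat_adjoint V * U * W" B] A B by (simp add: MA)
  qed
  have "psd_sqrt \<rho> * (U * \<sigma> * mat_adjoint U) * psd_sqrt \<rho> = V * (M * mat_adjoint M) * mat_adjoint V"
    unfolding sqrt \<sigma> BB Ma unfolding MA using v(1) w(1) u(1) A(1) B(1)
    by (simp add: assoc_mult_mat[of _ n n _ n _ n])
  moreover have "Re (mtrace (psd_sqrt (V * (M * mat_adjoint M) * mat_adjoint V))) = trace_norm M"
    using trace_norm_decomposition[OF M] V by metis
  ultimately show ?thesis by (simp add: fidelity_def M_def)
qed

theorem theorem2:
  fixes d :: nat and \<rho> \<sigma> :: "complex mat"
  assumes "density_mat d \<rho>" and "density_mat d \<sigma>"
  shows "{fidelity \<rho> (U * \<sigma> * mat_adjoint U) | U. unitary_mat d U}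
       = {(\<Sum>j<d. sqrt (eig_down \<rho> ! j * eig_up \<sigma> ! j)) ..
          (\<Sum>j<d. sqrt (eig_down \<rho> ! j * eig_down \<sigma> ! j))}"
proof -
  have psd: "psd_mat d \<rho>" "psd_mat d \<sigma>" using assms by (auto simp: density_mat_def)
  obtain V where V: "unitary_mat d V"
    and \<rho>: "\<rho> = V * mat_diag d (\<lambda>i. complex_of_real (eig_down \<rho> ! i)) * mat_adjoint V"
    and l\<rho>: "length (eig_down \<rho>) = d" and p\<rho>: "\<And>i. i < d \<Longrightarrow> 0 \<le> eig_down \<rho> ! i"
    using spectral_psd[OF psd(1)] by metis
  obtain W where W: "unitary_mat d W"
    and \<sigma>: "\<sigma> = W * mat_diag d (\<lambda>i. complex_of_real (eig_down \<sigma> ! i)) * mat_adjoint W"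
    and l\<sigma>: "length (eig_down \<sigma>) = d" and p\<sigma>: "\<And>i. i < d \<Longrightarrow> 0 \<le> eig_down \<sigma> ! i"
    using spectral_psd[OF psd(2)] by metis
  note v = unitary_matD[OF V] and w = unitary_matD[OF W]
  define a b where "a i = sqrt (eig_down \<rho> ! i)" and "b i = sqrt (eig_down \<sigma> ! i)" for i
  have a0: "0 \<le> a i" if "i < d" for i using p\<rho>[OF that] by (simp add: a_def)
  have b0: "0 \<le> b i" if "i < d" for i using p\<sigma>[OF that] by (simp add: b_def)
  have a: "a j \<le> a i" if "i \<le> j" "j < d" for i j
    using eig_down_antimono[of i j \<rho>] that l\<rho> by (simp add: a_def)
  have b: "b j \<le> b i" if "i \<le> j" "j < d" for i j
    using eig_down_antimono[of i j \<sigma>] that l\<sigma> by (simp add: b_def)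
  have "mat_diag d (\<lambda>i. complex_of_real (eig_down \<rho> ! i)) = mat_diag d (\<lambda>i. complex_of_real ((a i)\<^sup>2))"
    using p\<rho> by (intro mat_diag_cong) (simp add: a_def)
  then have \<rho>': "\<rho> = V * mat_diag d (\<lambda>i. complex_of_real ((a i)\<^sup>2)) * mat_adjoint V" using \<rho> by simp
  have "mat_diag d (\<lambda>i. complex_of_real (eig_down \<sigma> ! i)) = mat_diag d (\<lambda>i. complex_of_real ((b i)\<^sup>2))"
    using p\<sigma> by (intro mat_diag_cong) (simp add: b_def)
  then have \<sigma>': "\<sigma> = W * mat_diag d (\<lambda>i. complex_of_real ((b i)\<^sup>2)) * mat_adjoint W" using \<sigma> by simp
  have fid: "fidelity \<rho> (U * \<sigma> * mat_adjoint U) = trace_norm (sandwich d a b (mat_adjoint V * U * W))"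
    if "unitary_mat d U" for U
    by (rule fidelity_unitary_diag[OF V W that a0 \<rho>' \<sigma>'])
  have "{fidelity \<rho> (U * \<sigma> * mat_adjoint U) | U. unitary_mat d U} =
      {trace_norm (sandwich d a b X) | X. unitary_mat d X}"
  proof (intro equalityI subsetI)
    fix y assume "y \<in> {fidelity \<rho> (U * \<sigma> * mat_adjoint U) | U. unitary_mat d U}"
    then obtain U where U: "unitary_mat d U" and y: "y = fidelity \<rho> (U * \<sigma> * mat_adjoint U)" by auto
    have "unitary_mat d (mat_adjoint V * U * W)"
      by (intro unitary_mat_mult unitary_mat_adjoint U V W)
    then show "y \<in> {trace_norm (sandwich d a b X) | X. unitary_mat d X}"
      unfolding y fid[OF U] by blast
  next
    fix y assume "y \<in> {trace_norm (sandwich d a b X) | X. unitary_mat d X}"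
    then obtain X where X: "unitary_mat d X" and y: "y = trace_norm (sandwich d a b X)" by auto
    \<comment> \<open>The solution \<open>U\<close> of V^* U W = X, which makes the correspondence
      of \<open>U\<close> and \<open>X\<close> surjective.\<close>
    have U: "unitary_mat d (V * X * mat_adjoint W)"
      by (intro unitary_mat_mult unitary_mat_adjoint X V W)
    have "mat_adjoint V * (V * X * mat_adjoint W) * W = (mat_adjoint V * V) * X * (mat_adjoint W * W)"
      using v(1) w(1) unitary_matD(1)[OF X] by (simp add: assoc_mult_mat[of _ d d _ d _ d])
    also have "\<dots> = X"
      unfolding v(3) w(3) using unitary_matD(1)[OF X] by simp
    finally have "mat_adjoint V * (V * X * mat_adjoint W) * W = X" .
    then have "y = fidelity \<rho> ((V * X * mat_adjoint W) * \<sigma> * mat_adjoint (V * X * mat_adjoint W))"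
      unfolding y fid[OF U] by simp
    with U show "y \<in> {fidelity \<rho> (U * \<sigma> * mat_adjoint U) | U. unitary_mat d U}" by blast
  qed
  also have "\<dots> = {(\<Sum>j<d. a j * b (d - Suc j)) .. (\<Sum>j<d. a j * b j)}"
    by (rule trace_norm_sandwich_range[OF a a0 b b0])
  \<comment> \<open>\<open>eig_down\<close> is the reverse of \<open>eig_up\<close>, so its entry at
    \<open>d - Suc j\<close> is the entry of \<open>eig_up\<close> at \<open>j\<close>.\<close>
  also have "(\<Sum>j<d. a j * b (d - Suc j)) = (\<Sum>j<d. sqrt (eig_down \<rho> ! j * eig_up \<sigma> ! j))"
    using l\<sigma> by (intro sum.cong)
      (auto simp: a_def b_def eig_down_def rev_nth real_sqrt_mult)
  also have "(\<Sum>j<d. a j * b j) = (\<Sum>j<d. sqrt (eig_down \<rho> ! j * eig_down \<sigma> ! j))"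
    by (simp add: a_def b_def real_sqrt_mult)
  finally show ?thesis .
qed

end
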